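(* Let $T$ be a finite nonabelian simple group such that $T=\langle a,b\rangle$, where $a$ is an involution and $b^c\neq ba$ for every $c\in \mathbf{C}_{\mathrm{Aut}(T)}(a)$. Let $G:=N\rtimes\langle\iota\rangle$, where $N=T\times T$ and $\iota:N\to N$ is the automorphism defined by $(x,y)^\iota=(y,x)$ for every $(x,y)\in N$. Let $H=\langle (a,a),\iota\rangle$, $g=(b,ba)\in N$, and $\Gamma=\mathrm{Cos}(G,H,g)$. Then $(\Gamma,G)\in\mathcal{OG}(4)$ is basic of quasiprimitive type, $N$ is the unique minimal normal subgroup of $G$, and $H\cong\mathbb{Z}_2\times\mathbb{Z}_2$.
   Context: All graphs are finite, simple and undirected. $\mathbf{C}_{\mathrm{Aut}(T)}(a)$ denotes the group of automorphisms of $T$ fixing $a$, and $b^c$ is the image of $b$ under $c\in\mathrm{Aut}(T)$. For a group $G$, a proper subgroup $H$ and an element $s\in G$, the coset graph $\mathrm{Cos}(G,H,s)$ is the undirected graph with vertex set $\{Hx\mid x\in G\}$ and with $\{Hx,Hy\}$ an edge if and only if $xy^{-1}\in HsH$ or $yx^{-1}\in HsH$; $G$ acts on it by right multiplication. $\mathcal{OG}(4)$ is the set of pairs $(\Gamma,G)$ where $\Gamma$ is a connected graph of valency $4$ with vertex set $X$, and $G\leq\mathrm{Aut}(\Gamma)$ is transitive on $X$ and on edges, and $\Gamma$ is $G$-oriented: there is a $G$-orbit $\Delta\subset X\times X$, disjoint from $\Delta^*=\{(y,x)\mid (x,y)\in\Delta\}$, such that the edges of $\Gamma$ are exactly the pairs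 $\{x,y\}$ with $(x,y)\in\Delta$ or $(y,x)\in\Delta$. (For the coset graph, $G\leq\mathrm{Aut}(\Gamma)$ means that the right multiplication action of $G$ is faithful.) A pair $(\Gamma,G)\in\mathcal{OG}(4)$ is basic of quasiprimitive type if $G$ is quasiprimitive on $X$, that is, every nontrivial normal subgroup of $G$ is transitive on $X$. *)

theory Defs
  imports "Graph_Theory.Graph_Theory" "HOL-Algebra.Algebra"
begin

definition aut_centralizer :: "('a, 'm) monoid_scheme \<Rightarrow> 'a \<Rightarrow> ('a \<Rightarrow> 'a) set" where
  "aut_centralizer T a = {c \<in> auto T. c a = a}"

text \<open>
  The external semidirect product of \<open>N\<close> by a group \<open>K\<close> of automorphisms of \<open>N\<close>. As
  \<^const>\<open>AutoGroup\<close> composes functions from right to left, automorphisms act on the left here: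
  \<open>(\<one>, \<sigma>) (n, \<one>) (\<one>, \<sigma>)\<inverse> = (\<sigma> n, \<one>)\<close>. For \<open>K\<close> generated by an involution this is the same group
  as in the convention \<open>\<sigma>\<inverse> n \<sigma> = n\<^sup>\<sigma>\<close>.
\<close>

definition semidirect :: "('a, 'm) monoid_scheme \<Rightarrow> ('a \<Rightarrow> 'a) set \<Rightarrow> ('a \<times> ('a \<Rightarrow> 'a)) monoid" where
  "semidirect N K =
    \<lparr>carrier = carrier N \<times> K,
     mult = (\<lambda>(n, \<sigma>) (m, \<tau>). (n \<otimes>\<^bsub>N\<^esub> \<sigma> m, \<sigma> \<otimes>\<^bsub>AutoGroup N\<^esub> \<tau>)),
     one = (\<one>\<^bsub>N\<^esub>, \<one>\<^bsub>AutoGroup N\<^esub>)\<rparr>"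

text \<open>
  Finite simple undirected graphs are rendered by \<^locale>\<open>pair_graph\<close>, i.e. as finite symmetric
  loop-free relations: an edge \<open>{u, v}\<close> is the pair of arcs \<open>(u, v)\<close>, \<open>(v, u)\<close>, and the valency of
  a vertex is its out-degree.
\<close>

definition uedges :: "'v pair_pre_digraph \<Rightarrow> 'v set set" where
  "uedges \<Gamma> = {{u, v} | u v. (u, v) \<in> parcs \<Gamma>}"

definition graph_auts :: "'v pair_pre_digraph \<Rightarrow> ('v \<Rightarrow> 'v) set" where
  "graph_auts \<Gamma> = {f \<in> Bij (pverts \<Gamma>).
     \<forall>u \<in> pverts \<Gamma>. \<forall>v \<in> pverts \<Gamma>. (f u, f v) \<in> parcs \<Gamma> \<longleftrightarrow> (u, v) \<in> parcs \<Gamma>}"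

definition coset_graph :: "('a, 'm) monoid_scheme \<Rightarrow> 'a set \<Rightarrow> 'a \<Rightarrow> 'a set pair_pre_digraph" where
  "coset_graph G H s =
    \<lparr>pverts = rcosets\<^bsub>G\<^esub> H,
     parcs = {(H #>\<^bsub>G\<^esub> x, H #>\<^bsub>G\<^esub> y) | x y. x \<in> carrier G \<and> y \<in> carrier G \<and>
       (x \<otimes>\<^bsub>G\<^esub> inv\<^bsub>G\<^esub> y \<in> H <#>\<^bsub>G\<^esub> {s} <#>\<^bsub>G\<^esub> H \<or>
        y \<otimes>\<^bsub>G\<^esub> inv\<^bsub>G\<^esub> x \<in> H <#>\<^bsub>G\<^esub> {s} <#>\<^bsub>G\<^esub> H)}\<rparr>"

text \<open>
  The right multiplication action on right cosets. \<^locale>\<open>group_action\<close> is about left actions,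
  so the right action \<open>(H x, g) \<mapsto> H x g\<close> is read as the left action \<open>g \<cdot> H x = H x g\<inverse>\<close>.
  Passing to the inverse changes neither the permutation group induced by a subgroup, nor its
  orbits, nor the kernel.
\<close>

definition coset_action :: "('a, 'm) monoid_scheme \<Rightarrow> 'a set \<Rightarrow> 'a \<Rightarrow> 'a set \<Rightarrow> 'a set" where
  "coset_action G H g = (\<lambda>C \<in> rcosets\<^bsub>G\<^esub> H. C #>\<^bsub>G\<^esub> inv\<^bsub>G\<^esub> g)"

definition oriented ::
    "'v pair_pre_digraph \<Rightarrow> ('a, 'm) monoid_scheme \<Rightarrow> ('a \<Rightarrow> 'v \<Rightarrow> 'v) \<Rightarrow> bool" where
  "oriented \<Gamma> G \<phi> \<longleftrightarrow>
    (\<exists>x \<in> pverts \<Gamma>. \<exists>y \<in> pverts \<Gamma>. \<exists>\<Delta>.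
       \<Delta> = orbit G (\<lambda>g. map_prod (\<phi> g) (\<phi> g)) (x, y) \<and>
       \<Delta> \<inter> \<Delta>\<inverse> = {} \<and> parcs \<Gamma> = \<Delta> \<union> \<Delta>\<inverse>)"

text \<open>
  Membership of \<open>(\<Gamma>, G)\<close> in \<open>\<O>\<G>(4)\<close>, where \<open>G\<close> is regarded as a group of automorphisms of \<open>\<Gamma>\<close> by
  means of the faithful action \<open>\<phi>\<close>.
\<close>

definition in_OG4 ::
    "'v pair_pre_digraph \<Rightarrow> ('a, 'm) monoid_scheme \<Rightarrow> ('a \<Rightarrow> 'v \<Rightarrow> 'v) \<Rightarrow> bool" where
  "in_OG4 \<Gamma> G \<phi> \<longleftrightarrow>
     pair_graph \<Gamma> \<and>
     connected (with_proj \<Gamma>) \<and>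
     (\<forall>v \<in> pverts \<Gamma>. out_degree (with_proj \<Gamma>) v = 4) \<and>
     faithful_action G (pverts \<Gamma>) \<phi> \<and>
     \<phi> ` carrier G \<subseteq> graph_auts \<Gamma> \<and>
     transitive_action G (pverts \<Gamma>) \<phi> \<and>
     (\<forall>e \<in> uedges \<Gamma>. \<forall>e' \<in> uedges \<Gamma>. \<exists>g \<in> carrier G. \<phi> g ` e = e') \<and>
     oriented \<Gamma> G \<phi>"

definition quasiprimitive ::
    "('a, 'm) monoid_scheme \<Rightarrow> 'v set \<Rightarrow> ('a \<Rightarrow> 'v \<Rightarrow> 'v) \<Rightarrow> bool" where
  "quasiprimitive G V \<phi> \<longleftrightarrow>
     (\<forall>M. M \<lhd> G \<and> M \<noteq> {\<one>\<^bsub>G\<^esub>} \<longrightarrow> transitive_action (G\<lparr>carrier := M\<rparr>) V \<phi>)"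

definition basic_quasiprimitive ::
    "'v pair_pre_digraph \<Rightarrow> ('a, 'm) monoid_scheme \<Rightarrow> ('a \<Rightarrow> 'v \<Rightarrow> 'v) \<Rightarrow> bool" where
  "basic_quasiprimitive \<Gamma> G \<phi> \<longleftrightarrow> in_OG4 \<Gamma> G \<phi> \<and> quasiprimitive G (pverts \<Gamma>) \<phi>"

definition minimal_normal :: "'a set \<Rightarrow> ('a, 'm) monoid_scheme \<Rightarrow> bool" where
  "minimal_normal M G \<longleftrightarrow>
     M \<lhd> G \<and> M \<noteq> {\<one>\<^bsub>G\<^esub>} \<and>
     (\<forall>L. L \<lhd> G \<and> L \<subseteq> M \<and> L \<noteq> {\<one>\<^bsub>G\<^esub>} \<longrightarrow> L = M)"

end

theory Submission
  imports Defs
begin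

text \<open>
  Since \<open>\<iota> g \<iota> = g (a, a)\<close>, the double coset \<open>H g H\<close> consists of only two right cosets, and likewise
  \<open>H g\<inverse> H\<close>; if the two double cosets coincided, \<open>a\<close> and \<open>b\<close> would commute, so the graph is oriented of
  valency 4. Connectivity means that \<open>H\<close> and \<open>g\<close> generate \<open>G\<close>: the part of the generated group inside
  \<open>T \<times> T\<close> projects onto both factors, so by Goursat's lemma and simplicity it is \<open>T \<times> T\<close> or the graph
  of an automorphism of \<open>T\<close>. The latter would fix \<open>a\<close> and send \<open>b\<close> to \<open>b a\<close>, which is excluded.
  Commutators with elements \<open>(t, 1)\<close> show that every nontrivial normal subgroup of \<open>G\<close> contains
  \<open>T \<times> T\<close>; hence \<open>H\<close> is core-free, and \<open>G = H N\<close> gives quasiprimitivity.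
\<close>

section \<open>Coset graphs\<close>

definition double_coset :: "('a, 'm) monoid_scheme \<Rightarrow> 'a set \<Rightarrow> 'a \<Rightarrow> 'a set" where
  "double_coset G H s = H <#>\<^bsub>G\<^esub> {s} <#>\<^bsub>G\<^esub> H"

lemma mem_double_coset:
  "d \<in> double_coset G H s \<longleftrightarrow> (\<exists>h\<in>H. \<exists>k\<in>H. d = h \<otimes>\<^bsub>G\<^esub> s \<otimes>\<^bsub>G\<^esub> k)"
  by (auto simp: double_coset_def set_mult_def)

locale group_with_subgroup = group G + subgroup H G for G (structure) and H
begin

lemma rcos_eq_iff:
  assumes "x \<in> carrier G" "y \<in> carrier G"
  shows "H #> x = H #> y \<longleftrightarrow> x \<otimes> inv y \<in> H"
  using assms
  by (metis is_group is_subgroup repr_independence repr_independenceD rcos_module subgroup_axioms rcos_self)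

lemma self_mem_double_coset [simp]: "s \<in> carrier G \<Longrightarrow> s \<in> double_coset G H s"
  by (auto simp: mem_double_coset intro!: bexI[of _ \<one>])

lemma double_coset_absorb:
  assumes "s \<in> carrier G" "d \<in> double_coset G H s" "h \<in> H" "k \<in> H"
  shows "h \<otimes> d \<otimes> k \<in> double_coset G H s"
proof -
  obtain h' k' where *: "h' \<in> H" "k' \<in> H" "d = h' \<otimes> s \<otimes> k'"
    using assms by (auto simp: mem_double_coset)
  have "h \<otimes> d \<otimes> k = (h \<otimes> h') \<otimes> s \<otimes> (k' \<otimes> k)"
    using * assms by (simp add: m_assoc)
  then show ?thesis using * assms by (auto simp: mem_double_coset)
qed

text \<open>Arcs are declared through some pair of representatives. Replacing \<open>x\<close> and
  \<open>y\<close> inside their cosets multiplies \<open>x \<otimes> inv y\<close> by elements of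
  \<open>H\<close> on both sides, which the double coset absorbs, so any representatives may be
  tested.\<close>

lemma double_coset_rcos_cong:
  assumes "s \<in> carrier G" "x \<in> carrier G" "x' \<in> carrier G" "y \<in> carrier G" "y' \<in> carrier G"
    and "H #> x = H #> x'" "H #> y = H #> y'" and "x \<otimes> inv y \<in> double_coset G H s"
  shows "x' \<otimes> inv y' \<in> double_coset G H s"
proof -
  have "x' \<otimes> inv x \<in> H" "y \<otimes> inv y' \<in> H"
    using assms rcos_eq_iff by metis+
  then have "(x' \<otimes> inv x) \<otimes> (x \<otimes> inv y) \<otimes> (y \<otimes> inv y') \<in> double_coset G H s"
    using assms by (intro double_coset_absorb)
  moreover have "(x' \<otimes> inv x) \<otimes> (x \<otimes> inv y) \<otimes> (y \<otimes> inv y') = x' \<otimes> inv y'"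
    using assms by (simp add: inv_solve_left' m_assoc)
  ultimately show ?thesis by simp
qed

lemma coset_graph_arc_iff:
  assumes "s \<in> carrier G" "x \<in> carrier G" "y \<in> carrier G"
  shows "(H #> x, H #> y) \<in> parcs (coset_graph G H s) \<longleftrightarrow>
    x \<otimes> inv y \<in> double_coset G H s \<or> y \<otimes> inv x \<in> double_coset G H s"
proof
  assume "(H #> x, H #> y) \<in> parcs (coset_graph G H s)"
  then obtain x' y' where "x' \<in> carrier G" "y' \<in> carrier G"
    "H #> x = H #> x'" "H #> y = H #> y'"
    "x' \<otimes> inv y' \<in> double_coset G H s \<or> y' \<otimes> inv x' \<in> double_coset G H s"
    by (auto simp: coset_graph_def double_coset_def)
  then show "x \<otimes> inv y \<in> double_coset G H s \<or> y \<otimes> inv x \<in> double_coset G H s"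
    using double_coset_rcos_cong assms by metis
qed (use assms in \<open>auto simp: coset_graph_def double_coset_def\<close>)

lemma coset_graph_arcE:
  assumes "e \<in> parcs (coset_graph G H s)"
  obtains x y where "x \<in> carrier G" "y \<in> carrier G" "e = (H #> x, H #> y)"
  using assms by (auto simp: coset_graph_def)

lemma pverts_coset_graph [simp]: "pverts (coset_graph G H s) = rcosets H"
  by (simp add: coset_graph_def)

lemma rcosetsE:
  assumes "C \<in> rcosets H"
  obtains x where "x \<in> carrier G" "C = H #> x"
  using assms by (auto simp: RCOSETS_def)

section \<open>The action on cosets, and double cosets as unions of cosets\<close>

lemma coset_action_rcos:
  assumes "x \<in> carrier G" "g \<in> carrier G"
  shows "coset_action G H g (H #> x) = H #> (x \<otimes> inv g)"
  using assms by (simp add: coset_action_def rcosetsI subset coset_mult_assoc)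

lemma group_action_coset_action: "group_action G (rcosets H) (coset_action G H)"
proof -
  have closed: "coset_action G H g C \<in> rcosets H" if "g \<in> carrier G" "C \<in> rcosets H" for g C
    using that by (auto elim!: rcosetsE simp: coset_action_rcos intro!: rcosetsI subset)
  have mult: "coset_action G H (g \<otimes> h) C = coset_action G H g (coset_action G H h C)"
    if "g \<in> carrier G" "h \<in> carrier G" "C \<in> rcosets H" for g h C
    using that by (auto elim!: rcosetsE simp: coset_action_rcos inv_mult_group m_assoc)
  have one: "coset_action G H \<one> C = C" if "C \<in> rcosets H" for C
    using that by (auto elim!: rcosetsE simp: coset_action_rcos)
  have bij: "coset_action G H g \<in> Bij (rcosets H)" if g: "g \<in> carrier G" for g
  proof -
    have "bij_betw (coset_action G H g) (rcosets H) (rcosets H)"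
      by (rule bij_betw_byWitness[where f' = "coset_action G H (inv g)"])
        (use g closed in \<open>auto simp: mult[symmetric] one\<close>)
    then show ?thesis by (simp add: Bij_def coset_action_def)
  qed
  show ?thesis
  proof (intro group_action.intro group_hom.intro group_hom_axioms.intro homI)
    fix g h assume gh: "g \<in> carrier G" "h \<in> carrier G"
    show "coset_action G H (g \<otimes> h) =
      coset_action G H g \<otimes>\<^bsub>BijGroup (rcosets H)\<^esub> coset_action G H h"
    proof (rule ext)
      fix C show "coset_action G H (g \<otimes> h) C =
        (coset_action G H g \<otimes>\<^bsub>BijGroup (rcosets H)\<^esub> coset_action G H h) C"
      proof (cases "C \<in> rcosets H")
        case True
        then show ?thesis using gh bij mult by (simp add: BijGroup_def compose_def)
      next
        \<comment> \<open>Elements of \<open>BijGroup\<close> are extensional: off the cosets both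
          sides are \<open>undefined\<close>.\<close>
        case False
        then show ?thesis
          using gh bij by (simp add: BijGroup_def compose_def) (simp add: coset_action_def)
      qed
    qed
  qed (use bij in \<open>auto simp: BijGroup_def group_BijGroup[unfolded BijGroup_def]\<close>)
qed

text \<open>If \<open>G = H M\<close>, every right coset of \<open>H\<close> has a representative in
  \<open>M\<close>. Used with \<open>M = G\<close> for vertex transitivity and with normal
  \<open>M\<close> for quasiprimitivity.\<close>

lemma transitive_coset_action:
  assumes "subgroup M G" and "carrier G \<subseteq> H <#> M"
  shows "transitive_action (G\<lparr>carrier := M\<rparr>) (rcosets H) (coset_action G H)"
proof -
  interpret act: group_action G "rcosets H" "coset_action G H"
    by (rule group_action_coset_action)
  interpret M: subgroup M G by fact
  show ?thesis
  proof (intro transitive_action.intro transitive_action_axioms.intro group_action.intro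
      group_hom.intro group_hom_axioms.intro)
    show "group (G\<lparr>carrier := M\<rparr>)"
      by (rule M.subgroup_is_group[OF is_group])
    show "coset_action G H \<in> hom (G\<lparr>carrier := M\<rparr>) (BijGroup (rcosets H))"
      using group_hom.homh[OF act.group_hom] M.subset by (auto simp: hom_def)
    fix C D assume "C \<in> rcosets H" "D \<in> rcosets H"
    moreover have "\<exists>m\<in>M. C = H #> m" if "C \<in> rcosets H" for C
    proof -
      obtain x where x: "x \<in> carrier G" "C = H #> x" using \<open>C \<in> rcosets H\<close> by (rule rcosetsE)
      then obtain h m where "h \<in> H" "m \<in> M" "x = h \<otimes> m"
        using assms(2) by (auto simp: set_mult_def)
      moreover from this have "x \<otimes> inv m = h"
        by (simp add: m_assoc M.mem_carrier)
      ultimately show ?thesis using x rcos_eq_iff M.mem_carrier by metis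
    qed
    ultimately obtain m n where mn: "m \<in> M" "C = H #> m" "n \<in> M" "D = H #> n" by meson
    \<comment> \<open>The action multiplies by the inverse, here \<open>inv m \<otimes> n\<close>,
      and \<open>m \<otimes> (inv m \<otimes> n) = n\<close>.\<close>
    have "coset_action G H (inv n \<otimes> m) C = D"
      using mn by (simp add: coset_action_rcos M.mem_carrier inv_mult_group m_assoc[symmetric])
    then show "\<exists>g\<in>carrier (G\<lparr>carrier := M\<rparr>). coset_action G H g C = D"
      using mn by auto
  qed (rule group_BijGroup)
qed

lemma faithful_coset_action:
  assumes "\<And>M. M \<lhd> G \<Longrightarrow> M \<subseteq> H \<Longrightarrow> M = {\<one>}"
  shows "faithful_action G (rcosets H) (coset_action G H)"
proof -
  interpret act: group_action G "rcosets H" "coset_action G H"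
    by (rule group_action_coset_action)
  interpret gh: group_hom G "BijGroup (rcosets H)" "coset_action G H"
    by (rule act.group_hom)
  have "kernel G (BijGroup (rcosets H)) (coset_action G H) \<subseteq> H"
  proof
    fix g assume "g \<in> kernel G (BijGroup (rcosets H)) (coset_action G H)"
    then have g: "g \<in> carrier G" "coset_action G H g = (\<lambda>C\<in>rcosets H. C)"
      by (auto simp: kernel_def BijGroup_def)
    \<comment> \<open>The coset \<open>H #> g\<close> is a convenient test point: \<open>g\<close>
      sends it to \<open>H\<close> itself, so a kernel element satisfies
      \<open>H #> g = H\<close>.\<close>
    then have "coset_action G H g (H #> g) = H #> g"
      by (simp add: rcosetsI subset)
    then show "g \<in> H"
      using g by (metis coset_action_rcos coset_mult_one r_inv subset rcos_self is_subgroup)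
  qed
  then have "kernel G (BijGroup (rcosets H)) (coset_action G H) = {\<one>}"
    using assms gh.normal_kernel by blast
  then have "inj_on (coset_action G H) (carrier G)"
    by (simp add: gh.inj_iff_trivial_ker)
  then show ?thesis
    by (intro faithful_action.intro act.group_action_axioms faithful_action_axioms.intro)
qed

text \<open>\<open>H s H\<close> is the union of the cosets \<open>H #> (s \<otimes> h)\<close> with
  \<open>h\<close> in \<open>H\<close>. This turns counting neighbours into counting such
  cosets.\<close>

lemma rcos_mem_iff_double_coset:
  assumes "s \<in> carrier G" "d \<in> carrier G"
  shows "H #> d \<in> (\<lambda>h. H #> (s \<otimes> h)) ` H \<longleftrightarrow> d \<in> double_coset G H s"
proof
  assume "H #> d \<in> (\<lambda>h. H #> (s \<otimes> h)) ` H"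
  then obtain h where "h \<in> H" "H #> d = H #> (s \<otimes> h)" by auto
  then have "d \<in> H #> (s \<otimes> h)"
    using assms by (metis rcos_self is_subgroup)
  then show "d \<in> double_coset G H s"
    using assms \<open>h \<in> H\<close> by (force simp: mem_double_coset r_coset_def m_assoc)
next
  assume "d \<in> double_coset G H s"
  then obtain h k where "h \<in> H" "k \<in> H" "d = h \<otimes> s \<otimes> k"
    by (auto simp: mem_double_coset)
  then have "H #> d = H #> (s \<otimes> k)"
    using assms by (simp add: rcos_eq_iff inv_mult_group m_assoc) (simp add: m_assoc[symmetric])
  then show "H #> d \<in> (\<lambda>h. H #> (s \<otimes> h)) ` H" using \<open>k \<in> H\<close> by auto
qed

lemma inv_mem_double_coset:
  assumes "s \<in> carrier G" "d \<in> double_coset G H s"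
  shows "inv d \<in> double_coset G H (inv s)"
proof -
  obtain h k where "h \<in> H" "k \<in> H" "d = h \<otimes> s \<otimes> k"
    using assms by (auto simp: mem_double_coset)
  then have "inv k \<in> H" "inv h \<in> H" "inv d = inv k \<otimes> inv s \<otimes> inv h"
    using assms by (auto simp: inv_mult_group m_assoc)
  then show ?thesis by (auto simp: mem_double_coset)
qed

lemma inv_mem_double_coset_iff:
  assumes "s \<in> carrier G" "d \<in> carrier G"
  shows "inv d \<in> double_coset G H (inv s) \<longleftrightarrow> d \<in> double_coset G H s"
  using inv_mem_double_coset[of s d] inv_mem_double_coset[of "inv s" "inv d"] assms by auto

text \<open>Double cosets that meet coincide. In this form, disjointness of \<open>H s H\<close> and
  the double coset of \<open>inv s\<close> follows from the single condition
  \<open>inv_s_notin\<close>.\<close>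

lemma inv_mem_double_coset_of_mem_both:
  assumes "s \<in> carrier G" "d \<in> double_coset G H s" "d \<in> double_coset G H (inv s)"
  shows "inv s \<in> double_coset G H s"
proof -
  obtain h k where hk: "h \<in> H" "k \<in> H" "d = h \<otimes> inv s \<otimes> k"
    using assms by (auto simp: mem_double_coset)
  then have "inv s = inv h \<otimes> d \<otimes> inv k"
    using assms by (simp add: m_assoc) (simp add: m_assoc[symmetric])
  then show ?thesis using double_coset_absorb[of s d "inv h" "inv k"] assms hk by simp
qed

end

text \<open>
  Both \<open>H s H\<close> and \<open>H s\<inverse> H\<close> consist of two right cosets of \<open>H\<close>, and they are disjoint, so each
  vertex has two out-neighbours and two in-neighbours in the orientation.
\<close>

locale oriented_coset_graph = group_with_subgroup +
  fixes s
  assumes finite_carrier: "finite (carrier G)"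
    and s_closed [simp]: "s \<in> carrier G"
    and inv_s_notin: "inv s \<notin> double_coset G H s"
    and card_out: "card ((\<lambda>h. H #> (s \<otimes> h)) ` H) = 2"
    and card_in: "card ((\<lambda>h. H #> (inv s \<otimes> h)) ` H) = 2"
    and generates: "generate G (insert s H) = carrier G"
    and core_free: "\<And>M. M \<lhd> G \<Longrightarrow> M \<subseteq> H \<Longrightarrow> M = {\<one>}"
begin

section \<open>The coset graph as a connected simple graph of valency 4\<close>

abbreviation "\<Gamma> \<equiv> coset_graph G H s"

text \<open>Both orientations are expressed through the one quotient
  \<open>y \<otimes> inv x\<close>, so the neighbours of \<open>H #> x\<close> are the cosets
  \<open>H #> (d \<otimes> x)\<close> with \<open>d\<close> in either double coset.\<close>

lemma arc_iff:
  assumes "x \<in> carrier G" "y \<in> carrier G"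
  shows "(H #> x, H #> y) \<in> parcs \<Gamma> \<longleftrightarrow>
    y \<otimes> inv x \<in> double_coset G H s \<union> double_coset G H (inv s)"
  using assms inv_mem_double_coset_iff[of s "x \<otimes> inv y"]
  by (auto simp: coset_graph_arc_iff inv_mult_group)

lemma finite_rcosets: "finite (rcosets H)"
  using finite_carrier by (simp add: RCOSETS_def)

text \<open>This excludes loops. As \<open>\<one>\<close> is its own inverse, it would lie in both
  double cosets, which are disjoint.\<close>

lemma one_notin_double_coset: "\<one> \<notin> double_coset G H s"
proof
  assume "\<one> \<in> double_coset G H s"
  then have "inv \<one> \<in> double_coset G H (inv s)"
    using inv_mem_double_coset s_closed by blast
  then show False
    using \<open>\<one> \<in> double_coset G H s\<close> inv_mem_double_coset_of_mem_both inv_s_notin s_closed by simp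
qed

lemma parcs_subset: "parcs \<Gamma> \<subseteq> (rcosets H) \<times> (rcosets H)"
  by (auto elim!: coset_graph_arcE intro!: rcosetsI subset)

lemma parcs_sym: "(u, v) \<in> parcs \<Gamma> \<Longrightarrow> (v, u) \<in> parcs \<Gamma>"
  by (auto simp: coset_graph_def)

lemma pair_graph: "pair_graph \<Gamma>"
proof
  show "symmetric (with_proj \<Gamma>)"
    by (auto simp: symmetric_def sym_def parcs_sym)
  show "finite (parcs \<Gamma>)"
    using parcs_subset finite_rcosets by (meson finite_SigmaI finite_subset)
  show "fst e \<noteq> snd e" if e: "e \<in> parcs \<Gamma>" for e
  proof
    assume "fst e = snd e"
    obtain x y where "x \<in> carrier G" "y \<in> carrier G" "e = (H #> x, H #> y)"
      using e by (rule coset_graph_arcE)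
    then have "x \<in> carrier G" "(H #> x, H #> x) \<in> parcs \<Gamma>"
      using e \<open>fst e = snd e\<close> by auto
    then show False
      using one_notin_double_coset by (simp add: coset_graph_arc_iff)
  qed
  show "fst e \<in> pverts \<Gamma>" "snd e \<in> pverts \<Gamma>" if "e \<in> parcs \<Gamma>" for e
    using subsetD[OF parcs_subset that] by (simp_all add: mem_Times_iff)
qed (simp add: finite_rcosets)

text \<open>Right multiplication by \<open>x\<close> carries the neighbours of \<open>H\<close> to
  those of \<open>H #> x\<close>. The former are the two cosets in \<open>?A\<close> and the two in
  \<open>?B\<close>, and \<open>?A\<close> and \<open>?B\<close> are disjoint.\<close>

lemma out_degree:
  assumes "v \<in> rcosets H"
  shows "out_degree (with_proj \<Gamma>) v = 4"
proof -
  obtain x where x: "x \<in> carrier G" "v = H #> x" using assms by (rule rcosetsE)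
  let ?A = "(\<lambda>h. H #> (s \<otimes> h)) ` H" and ?B = "(\<lambda>h. H #> (inv s \<otimes> h)) ` H"
  have AB: "H #> d \<in> ?A \<union> ?B \<longleftrightarrow> d \<in> double_coset G H s \<union> double_coset G H (inv s)"
    if "d \<in> carrier G" for d
    using that rcos_mem_iff_double_coset[of s d] rcos_mem_iff_double_coset[of "inv s" d] by simp
  have sub: "?A \<union> ?B \<subseteq> rcosets H" by (auto intro!: rcosetsI subset)
  have inj: "inj_on (\<lambda>C. (v, C #> x)) (?A \<union> ?B)"
  proof (rule inj_onI)
    fix C D assume CD: "C \<in> ?A \<union> ?B" "D \<in> ?A \<union> ?B" "(v, C #> x) = (v, D #> x)"
    obtain c where "c \<in> carrier G" "C = H #> c" using subsetD[OF sub CD(1)] by (rule rcosetsE)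
    moreover obtain d where "d \<in> carrier G" "D = H #> d" using subsetD[OF sub CD(2)] by (rule rcosetsE)
    ultimately show "C = D"
      using CD(3) x by (simp add: coset_mult_assoc subset rcos_eq_iff inv_mult_group m_assoc)
        (simp add: m_assoc[symmetric])
  qed
  have "out_arcs (with_proj \<Gamma>) v = (\<lambda>C. (v, C #> x)) ` (?A \<union> ?B)" (is "?O = ?I")
  proof
    show "?O \<subseteq> ?I"
    proof
      fix e assume "e \<in> ?O"
      then have e: "e \<in> parcs \<Gamma>" "fst e = v" by auto
      then obtain y where y: "y \<in> carrier G" "e = (H #> x, H #> y)"
        using x by (auto elim!: coset_graph_arcE)
      then have "H #> (y \<otimes> inv x) \<in> ?A \<union> ?B"
        using e x by (subst AB) (auto simp: arc_iff)
      moreover have "H #> (y \<otimes> inv x) #> x = H #> y"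
        using x y by (simp add: coset_mult_assoc subset m_assoc)
      ultimately show "e \<in> ?I" using x y by force
    qed
    show "?I \<subseteq> ?O"
    proof
      fix e assume "e \<in> ?I"
      then obtain C where C: "e = (v, C #> x)" "C \<in> ?A \<union> ?B" by (rule imageE)
      obtain c where c: "c \<in> carrier G" "C = H #> c"
        using subsetD[OF sub C(2)] by (rule rcosetsE)
      then have "c \<in> double_coset G H s \<union> double_coset G H (inv s)"
        using C(2) AB[OF c(1)] by (simp only:)
      moreover have "C #> x = H #> (c \<otimes> x)" "c \<otimes> x \<otimes> inv x = c"
        using c x by (simp_all add: coset_mult_assoc subset m_assoc)
      ultimately show "e \<in> ?O" using x c C by (simp add: arc_iff)
    qed
  qed
  \<comment> \<open>A coset in both sets would have a representative in both double cosets.\<close>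
  moreover have "?A \<inter> ?B = {}"
  proof (rule ccontr)
    assume "?A \<inter> ?B \<noteq> {}"
    then obtain C where C: "C \<in> ?A" "C \<in> ?B" by (meson disjoint_iff)
    obtain h where "h \<in> H" "C = H #> (s \<otimes> h)" using C(1) by auto
    then have "s \<otimes> h \<in> double_coset G H s" "s \<otimes> h \<in> double_coset G H (inv s)"
      using rcos_mem_iff_double_coset[of s "s \<otimes> h"] rcos_mem_iff_double_coset[of "inv s" "s \<otimes> h"]
        C by simp_all
    then show False using inv_mem_double_coset_of_mem_both inv_s_notin s_closed by metis
  qed
  ultimately show ?thesis
    using card_in card_out card_Un_disjoint[of ?A ?B] inj
    by (simp add: out_degree_def card_image card_ge_0_finite)
qed

text \<open>A word in the generators is a walk: a letter from \<open>H\<close> leaves the coset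
  unchanged, while \<open>s\<close> and \<open>inv s\<close> each traverse an arc. The start
  \<open>x\<close> stays arbitrary so that walks can be concatenated.\<close>

lemma generate_rtrancl:
  assumes "w \<in> generate G (insert s H)" "x \<in> carrier G"
  shows "(H #> x, H #> (w \<otimes> x)) \<in> rtrancl_on (rcosets H) (parcs \<Gamma>)"
  using assms
proof (induction arbitrary: x rule: generate.induct)
  case one
  then show ?case by (simp add: rcosetsI subset rtrancl_on_refl)
next
  case (incl w)
  have "H #> (w \<otimes> x) = H #> x" if "w \<in> H"
    using that incl by (simp add: rcos_eq_iff m_assoc)
  moreover have "(H #> x, H #> (s \<otimes> x)) \<in> parcs \<Gamma>"
    using incl by (simp add: arc_iff m_assoc)
  moreover have "H #> x \<in> rcosets H" using incl by (simp add: rcosetsI subset)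
  ultimately show ?case
    using incl parcs_subset
    by (cases "w \<in> H") (auto intro: rtrancl_on_into_rtrancl_on[OF rtrancl_on_refl])
next
  case (inv w)
  have "H #> (inv w \<otimes> x) = H #> x" if "w \<in> H"
    using that inv by (simp add: rcos_eq_iff m_assoc)
  moreover have "(H #> x, H #> (inv s \<otimes> x)) \<in> parcs \<Gamma>"
    using inv by (simp add: arc_iff m_assoc)
  moreover have "H #> x \<in> rcosets H" using inv by (simp add: rcosetsI subset)
  ultimately show ?case
    using inv parcs_subset
    by (cases "w \<in> H") (auto intro: rtrancl_on_into_rtrancl_on[OF rtrancl_on_refl])
next
  case (eng v w)
  \<comment> \<open>The walk for \<open>w\<close> starts at \<open>x\<close>; the walk for
    \<open>v\<close> continues from \<open>w \<otimes> x\<close>.\<close>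
  have "v \<in> carrier G" "w \<in> carrier G"
    using eng.hyps generates by auto
  then show ?case
    using eng.IH(2)[of x] eng.IH(1)[of "w \<otimes> x"] eng.prems
    by (simp add: m_assoc) (blast intro: rtrancl_on_trans)
qed

lemma connected: "connected (with_proj \<Gamma>)"
  unfolding connected_conv
proof (intro conjI ballI)
  show "verts (with_proj \<Gamma>) \<noteq> {}" using subgroup_in_rcosets[OF is_group] by auto
  fix u v assume "u \<in> verts (with_proj \<Gamma>)" "v \<in> verts (with_proj \<Gamma>)"
  then obtain x y where xy: "x \<in> carrier G" "u = H #> x" "y \<in> carrier G" "v = H #> y"
    by (auto elim!: rcosetsE)
  then have "y \<otimes> inv x \<in> generate G (insert s H)" "y \<otimes> inv x \<otimes> x = y"
    by (simp_all add: generates m_assoc)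
  then have "(u, v) \<in> rtrancl_on (rcosets H) (parcs \<Gamma>)"
    using generate_rtrancl xy by metis
  moreover have "parcs \<Gamma> \<subseteq> (arcs_ends (with_proj \<Gamma>))\<^sup>s"
    by (auto simp: symcl_def)
  ultimately show "(u, v) \<in> rtrancl_on (verts (with_proj \<Gamma>)) ((arcs_ends (with_proj \<Gamma>))\<^sup>s)"
    using rtrancl_on_mono[OF _ order_refl] by simp
qed

section \<open>Vertex transitivity and graph automorphisms\<close>

lemma transitive: "transitive_action G (rcosets H) (coset_action G H)"
proof -
  have "\<one> \<otimes> x \<in> H <#> carrier G" if "x \<in> carrier G" for x
    using that unfolding set_mult_def by (intro UN_I[of \<one> H] UN_I[of x "carrier G"]) auto
  then have "x \<in> H <#> carrier G" if "x \<in> carrier G" for x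
    using that by simp
  then have "carrier G \<subseteq> H <#> carrier G" by blast
  then show ?thesis using transitive_coset_action[OF subgroup_self] by simp
qed

text \<open>Adjacency depends only on the quotient \<open>y \<otimes> inv x\<close>, from which a
  common right factor cancels.\<close>

lemma coset_action_arc:
  assumes "g \<in> carrier G" "u \<in> rcosets H" "v \<in> rcosets H"
  shows "(coset_action G H g u, coset_action G H g v) \<in> parcs \<Gamma> \<longleftrightarrow> (u, v) \<in> parcs \<Gamma>"
proof -
  obtain x y where xy: "x \<in> carrier G" "u = H #> x" "y \<in> carrier G" "v = H #> y"
    using assms by (auto elim!: rcosetsE)
  then have "y \<otimes> inv g \<otimes> inv (x \<otimes> inv g) = y \<otimes> inv x"
    using assms by (simp add: inv_mult_group m_assoc) (simp add: m_assoc[symmetric])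
  then show ?thesis using assms xy by (simp add: coset_action_rcos arc_iff)
qed

lemma coset_action_graph_auts: "coset_action G H ` carrier G \<subseteq> graph_auts \<Gamma>"
proof
  fix f assume "f \<in> coset_action G H ` carrier G"
  then obtain g where "g \<in> carrier G" "f = coset_action G H g" by blast
  then show "f \<in> graph_auts \<Gamma>"
    using group_action.bij_prop0[OF group_action_coset_action] coset_action_arc
    by (simp add: graph_auts_def)
qed

section \<open>The orientation and edge transitivity\<close>

abbreviation orientation (\<open>\<Delta>\<close>) where
  "\<Delta> \<equiv> orbit G (\<lambda>g. map_prod (coset_action G H g) (coset_action G H g)) (H #> s, H #> \<one>)"

lemma orientation_eq: "\<Delta> = {(H #> (s \<otimes> g), H #> g) | g. g \<in> carrier G}"
proof
  show "\<Delta> \<subseteq> {(H #> (s \<otimes> g), H #> g) | g. g \<in> carrier G}"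
    by (fastforce simp: orbit_def coset_action_rcos)
  \<comment> \<open>The action multiplies by inverses, so the base pair reaches this one under
    \<open>inv g\<close>.\<close>
  have "(H #> (s \<otimes> g), H #> g) \<in> \<Delta>" if "g \<in> carrier G" for g
    using that by (auto simp: orbit_def coset_action_rcos intro!: exI[of _ "inv g"])
  then show "{(H #> (s \<otimes> g), H #> g) | g. g \<in> carrier G} \<subseteq> \<Delta>" by blast
qed

lemma orientation_iff:
  assumes "x \<in> carrier G" "y \<in> carrier G"
  shows "(H #> x, H #> y) \<in> \<Delta> \<longleftrightarrow> x \<otimes> inv y \<in> double_coset G H s"
proof
  assume "(H #> x, H #> y) \<in> \<Delta>"
  then obtain g where "g \<in> carrier G" "H #> (s \<otimes> g) = H #> x" "H #> g = H #> y"
    by (auto simp: orientation_eq)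
  moreover from this have "s \<otimes> g \<otimes> inv g \<in> double_coset G H s" by (simp add: m_assoc)
  ultimately show "x \<otimes> inv y \<in> double_coset G H s"
    using assms double_coset_rcos_cong[of s "s \<otimes> g" x g y] by simp
next
  assume "x \<otimes> inv y \<in> double_coset G H s"
  then obtain h k where hk: "h \<in> H" "k \<in> H" "x \<otimes> inv y = h \<otimes> s \<otimes> k"
    by (auto simp: mem_double_coset)
  have "x = x \<otimes> inv y \<otimes> y"
    using assms by (simp add: m_assoc)
  then have "x = h \<otimes> (s \<otimes> (k \<otimes> y))"
    using assms hk by (simp add: m_assoc)
  \<comment> \<open>From \<open>x = h s k y\<close>: the left factors \<open>h\<close> and
    \<open>k\<close> can be absorbed into the cosets, which leaves the orbit form with group element
    \<open>k \<otimes> y\<close>.\<close>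
  then have "H #> x = H #> (s \<otimes> (k \<otimes> y))" "H #> y = H #> (k \<otimes> y)"
    using assms hk by (simp_all add: rcos_eq_iff m_assoc inv_mult_group) (simp_all add: m_assoc[symmetric])
  then show "(H #> x, H #> y) \<in> \<Delta>"
    using assms hk by (auto simp: orientation_eq)
qed

lemma orientationE:
  assumes "e \<in> \<Delta>"
  obtains x y where "x \<in> carrier G" "y \<in> carrier G" "e = (H #> x, H #> y)"
proof -
  obtain g where "g \<in> carrier G" "e = (H #> (s \<otimes> g), H #> g)"
    using assms unfolding orientation_eq by blast
  then show ?thesis using that[of "s \<otimes> g" g] by simp
qed

lemma parcs_eq_orientation: "parcs \<Gamma> = \<Delta> \<union> \<Delta>\<inverse>"
proof (intro equalityI subsetI)
  fix e assume "e \<in> parcs \<Gamma>"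
  moreover obtain x y where "x \<in> carrier G" "y \<in> carrier G" "e = (H #> x, H #> y)"
    using calculation by (rule coset_graph_arcE)
  ultimately show "e \<in> \<Delta> \<union> \<Delta>\<inverse>"
    by (simp add: coset_graph_arc_iff orientation_iff)
next
  fix e assume "e \<in> \<Delta> \<union> \<Delta>\<inverse>"
  then obtain x y where "x \<in> carrier G" "y \<in> carrier G" "e = (H #> x, H #> y)"
    by (cases e) (auto elim!: orientationE)
  then show "e \<in> parcs \<Gamma>"
    using \<open>e \<in> \<Delta> \<union> \<Delta>\<inverse>\<close> by (simp add: coset_graph_arc_iff orientation_iff)
qed

text \<open>If a pair and its reversal were both in \<open>\<Delta>\<close>, a quotient and its
  inverse would lie in \<open>H s H\<close>, so the two double cosets would meet.\<close>

lemma oriented: "oriented \<Gamma> G (coset_action G H)"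
proof -
  have "False" if "(u, v) \<in> \<Delta>" "(v, u) \<in> \<Delta>" for u v
  proof -
    obtain x y where xy: "x \<in> carrier G" "y \<in> carrier G" "u = H #> x" "v = H #> y"
      using \<open>(u, v) \<in> \<Delta>\<close> by (auto elim!: orientationE)
    then have "x \<otimes> inv y \<in> double_coset G H s" "y \<otimes> inv x \<in> double_coset G H s"
      using that by (simp_all add: orientation_iff)
    moreover have "inv (x \<otimes> inv y) = y \<otimes> inv x" using xy by (simp add: inv_mult_group)
    ultimately show False
      using inv_mem_double_coset[of s "x \<otimes> inv y"] inv_mem_double_coset_of_mem_both[of s "y \<otimes> inv x"]
        inv_s_notin by simp
  qed
  then have "\<Delta> \<inter> \<Delta>\<inverse> = {}" by auto
  moreover have "H #> s \<in> pverts \<Gamma>" "H #> \<one> \<in> pverts \<Gamma>"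
    by (simp_all add: rcosetsI subset del: coset_mult_one)
  ultimately show ?thesis
    unfolding oriented_def using parcs_eq_orientation by meson
qed

text \<open>Pairs in \<open>\<Delta>\<close> and their reversals give the same unordered edges, so
  every edge is \<open>{H #> (s \<otimes> g), H #> g}\<close>, and transitivity on
  \<open>\<Delta>\<close> suffices.\<close>

lemma edge_transitive:
  assumes "e \<in> uedges \<Gamma>" "e' \<in> uedges \<Gamma>"
  shows "\<exists>g \<in> carrier G. coset_action G H g ` e = e'"
proof -
  have "\<exists>g\<in>carrier G. e = {H #> (s \<otimes> g), H #> g}" if "e \<in> uedges \<Gamma>" for e
    using that by (auto simp: uedges_def parcs_eq_orientation orientation_eq)
  then obtain g g' where g: "g \<in> carrier G" "e = {H #> (s \<otimes> g), H #> g}"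
    "g' \<in> carrier G" "e' = {H #> (s \<otimes> g'), H #> g'}"
    using assms by meson
  then have "coset_action G H (inv g' \<otimes> g) ` e = e'"
    by (simp add: coset_action_rcos inv_mult_group m_assoc) (simp add: m_assoc[symmetric])
  then show ?thesis using g by blast
qed

theorem in_OG4: "in_OG4 \<Gamma> G (coset_action G H)"
  unfolding in_OG4_def
  unfolding pverts_coset_graph
  by (intro conjI ballI pair_graph connected out_degree faithful_coset_action core_free
      coset_action_graph_auts transitive edge_transitive oriented)

end

section \<open>The extension of \<open>T \<times> T\<close> by the swap\<close>

lemma carrier_AutoGroup: "carrier (AutoGroup N) = auto N"
  by (simp add: AutoGroup_def)

lemma mult_AutoGroup:
  "\<sigma> \<in> auto N \<Longrightarrow> \<tau> \<in> auto N \<Longrightarrow> \<sigma> \<otimes>\<^bsub>AutoGroup N\<^esub> \<tau> = compose (carrier N) \<sigma> \<tau>"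
  by (simp add: AutoGroup_def BijGroup_def auto_def)

lemma one_AutoGroup: "\<one>\<^bsub>AutoGroup N\<^esub> = (\<lambda>x\<in>carrier N. x)"
  by (simp add: AutoGroup_def BijGroup_def)

lemma auto_hom: "\<sigma> \<in> auto N \<Longrightarrow> \<sigma> \<in> hom N N"
  by (simp add: auto_def)

lemma auto_closed: "\<sigma> \<in> auto N \<Longrightarrow> x \<in> carrier N \<Longrightarrow> \<sigma> x \<in> carrier N"
  by (auto simp: auto_def hom_def)

lemma group_semidirect:
  assumes "group N" and "subgroup K (AutoGroup N)"
  shows "group (semidirect N K)"
proof -
  interpret N: group N by fact
  interpret Aut: group "AutoGroup N" by (rule N.AutoGroup)
  interpret K: subgroup K "AutoGroup N" by fact
  have aut: "\<sigma> \<in> auto N" if "\<sigma> \<in> K" for \<sigma>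
    using that K.subset by (auto simp: carrier_AutoGroup)
  have app: "(\<sigma> \<otimes>\<^bsub>AutoGroup N\<^esub> \<tau>) x = \<sigma> (\<tau> x)" if "\<sigma> \<in> K" "\<tau> \<in> K" "x \<in> carrier N" for \<sigma> \<tau> x
    using that aut by (simp add: mult_AutoGroup compose_eq)
  have hom: "\<sigma> (x \<otimes>\<^bsub>N\<^esub> y) = \<sigma> x \<otimes>\<^bsub>N\<^esub> \<sigma> y"
    if "\<sigma> \<in> K" "x \<in> carrier N" "y \<in> carrier N" for \<sigma> x y
    using that auto_hom[OF aut] by (auto simp: hom_def)
  have cl: "\<sigma> x \<in> carrier N" if "\<sigma> \<in> K" "x \<in> carrier N" for \<sigma> x
    using auto_closed[OF aut[OF that(1)] that(2)] .
  have one: "\<one>\<^bsub>AutoGroup N\<^esub> x = x" if "x \<in> carrier N" for x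
    using that by (simp add: one_AutoGroup)
  show ?thesis
  proof (rule groupI)
    fix p assume "p \<in> carrier (semidirect N K)"
    then obtain n \<sigma> where p: "p = (n, \<sigma>)" "n \<in> carrier N" "\<sigma> \<in> K"
      by (auto simp: semidirect_def)
    let ?\<tau> = "inv\<^bsub>AutoGroup N\<^esub> \<sigma>"
    \<comment> \<open>The first component is \<open>?\<tau>\<close> applied to \<open>inv n\<close>
      times \<open>n\<close>, that is, to the unit. Its image is idempotent by the second instance
      of \<open>hom\<close>, hence trivial.\<close>
    have "(?\<tau> (inv\<^bsub>N\<^esub> n), ?\<tau>) \<otimes>\<^bsub>semidirect N K\<^esub> p = \<one>\<^bsub>semidirect N K\<^esub>"
      using p hom[of ?\<tau> "inv\<^bsub>N\<^esub> n" n] hom[of ?\<tau> "\<one>\<^bsub>N\<^esub>" "\<one>\<^bsub>N\<^esub>"] cl[of ?\<tau> "\<one>\<^bsub>N\<^esub>"]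
      by (simp add: semidirect_def K.mem_carrier)
    moreover have "(?\<tau> (inv\<^bsub>N\<^esub> n), ?\<tau>) \<in> carrier (semidirect N K)"
      using p by (simp add: semidirect_def cl)
    ultimately show "\<exists>y\<in>carrier (semidirect N K). y \<otimes>\<^bsub>semidirect N K\<^esub> p = \<one>\<^bsub>semidirect N K\<^esub>"
      by blast
  qed (auto simp: semidirect_def app hom cl one N.m_assoc Aut.m_assoc K.mem_carrier)
qed

section \<open>Coordinates for the extension\<close>

definition swap :: "('a, 'm) monoid_scheme \<Rightarrow> 'a \<times> 'a \<Rightarrow> 'a \<times> 'a" where
  "swap T = (\<lambda>(x, y) \<in> carrier (T \<times>\<times> T). (y, x))"

definition swap_extension ::
    "('a, 'm) monoid_scheme \<Rightarrow> (('a \<times> 'a) \<times> ('a \<times> 'a \<Rightarrow> 'a \<times> 'a)) monoid" where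
  "swap_extension T = semidirect (T \<times>\<times> T) (generate (AutoGroup (T \<times>\<times> T)) {swap T})"

text \<open>\<open>base\<close> and \<open>twist\<close> describe the two cosets of
  \<open>T \<times> T\<close> in the extension: \<open>(x, y)\<close> and
  \<open>(x, y) \<iota>\<close>. Products then become identities in \<open>T\<close>, with no
  automorphism left to evaluate.\<close>

definition base ::
    "('a, 'm) monoid_scheme \<Rightarrow> 'a \<Rightarrow> 'a \<Rightarrow> ('a \<times> 'a) \<times> ('a \<times> 'a \<Rightarrow> 'a \<times> 'a)" where
  "base T x y = ((x, y), \<one>\<^bsub>AutoGroup (T \<times>\<times> T)\<^esub>)"

definition twist ::
    "('a, 'm) monoid_scheme \<Rightarrow> 'a \<Rightarrow> 'a \<Rightarrow> ('a \<times> 'a) \<times> ('a \<times> 'a \<Rightarrow> 'a \<times> 'a)" where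
  "twist T x y = ((x, y), swap T)"

definition base_group ::
    "('a, 'm) monoid_scheme \<Rightarrow> (('a \<times> 'a) \<times> ('a \<times> 'a \<Rightarrow> 'a \<times> 'a)) set" where
  "base_group T = carrier (T \<times>\<times> T) \<times> {\<one>\<^bsub>AutoGroup (T \<times>\<times> T)\<^esub>}"

text \<open>\<open>swap G\<close> is its own inverse, hence bijective; its restriction to the
  carrier supplies the extensionality that \<open>auto\<close> requires.\<close>

lemma (in group) swap_in_auto: "swap G \<in> auto (G \<times>\<times> G)"
proof -
  have "bij_betw (swap G) (carrier (G \<times>\<times> G)) (carrier (G \<times>\<times> G))"
    by (rule bij_betw_byWitness[where f' = "swap G"]) (auto simp: swap_def)
  then show ?thesis
    by (auto simp: auto_def Bij_def hom_def swap_def)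
qed

lemma (in group) swap_mult_swap:
  "swap G \<otimes>\<^bsub>AutoGroup (G \<times>\<times> G)\<^esub> swap G = \<one>\<^bsub>AutoGroup (G \<times>\<times> G)\<^esub>"
  by (simp add: mult_AutoGroup swap_in_auto one_AutoGroup compose_def) (auto simp: swap_def)

lemma (in group) group_AutoGroup_DirProd: "group (AutoGroup (G \<times>\<times> G))"
  by (intro group.AutoGroup DirProd_group group_axioms)

lemma (in group) generate_swap:
  "generate (AutoGroup (G \<times>\<times> G)) {swap G} = {\<one>\<^bsub>AutoGroup (G \<times>\<times> G)\<^esub>, swap G}"
proof -
  interpret Aut: group "AutoGroup (G \<times>\<times> G)" by (rule group_AutoGroup_DirProd)
  have mem: "swap G \<in> carrier (AutoGroup (G \<times>\<times> G))"
    by (simp add: carrier_AutoGroup swap_in_auto)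
  moreover have "inv\<^bsub>AutoGroup (G \<times>\<times> G)\<^esub> swap G = swap G"
    using mem swap_mult_swap by (intro Aut.inv_equality)
  ultimately have "subgroup {\<one>\<^bsub>AutoGroup (G \<times>\<times> G)\<^esub>, swap G} (AutoGroup (G \<times>\<times> G))"
    by (intro Aut.subgroupI) (auto simp: swap_mult_swap)
  then show ?thesis
    by (intro Aut.generateI[symmetric]) (auto dest: subgroup.one_closed)
qed

lemma (in group) group_swap_extension: "group (swap_extension G)"
  unfolding swap_extension_def
  by (intro group_semidirect DirProd_group group_axioms group.generate_is_subgroup
      group_AutoGroup_DirProd) (simp add: carrier_AutoGroup swap_in_auto)

text \<open>Nontriviality separates the swap from the identity automorphism, so that no
  \<open>base\<close> element is a \<open>twist\<close> element.\<close>

locale nontrivial_group = T: group T for T (structure) +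
  assumes nontrivial: "carrier T \<noteq> {\<one>}"

sublocale nontrivial_group \<subseteq> G: group "swap_extension T"
  by (rule T.group_swap_extension)

context nontrivial_group
begin

abbreviation G where "G \<equiv> swap_extension T"

lemma swap_neq_one: "swap T \<noteq> \<one>\<^bsub>AutoGroup (T \<times>\<times> T)\<^esub>"
proof -
  obtain x where "x \<in> carrier T" "x \<noteq> \<one>" using nontrivial by blast
  then have "swap T (x, \<one>) \<noteq> \<one>\<^bsub>AutoGroup (T \<times>\<times> T)\<^esub> (x, \<one>)"
    by (simp add: swap_def one_AutoGroup)
  then show ?thesis by metis
qed

lemma base_twist_inject [simp]:
  "base T x y = base T u v \<longleftrightarrow> x = u \<and> y = v"
  "twist T x y = twist T u v \<longleftrightarrow> x = u \<and> y = v"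
  "base T x y \<noteq> twist T u v" "twist T u v \<noteq> base T x y"
  using swap_neq_one by (auto simp: base_def twist_def)

lemma carrier_eq:
  "carrier G = {base T x y | x y. x \<in> carrier T \<and> y \<in> carrier T} \<union>
    {twist T x y | x y. x \<in> carrier T \<and> y \<in> carrier T}"
  by (auto simp: swap_extension_def semidirect_def T.generate_swap base_def twist_def)

lemma carrier_cases [consumes 1, case_names base twist]:
  assumes "p \<in> carrier G"
  obtains x y where "x \<in> carrier T" "y \<in> carrier T" "p = base T x y"
  | x y where "x \<in> carrier T" "y \<in> carrier T" "p = twist T x y"
  using assms by (auto simp: carrier_eq)

lemma mem_carrier_iff [simp]:
  "base T x y \<in> carrier G \<longleftrightarrow> x \<in> carrier T \<and> y \<in> carrier T"
  "twist T x y \<in> carrier G \<longleftrightarrow> x \<in> carrier T \<and> y \<in> carrier T"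
  by (auto simp: carrier_eq)

lemma base_mem_base_group [simp]:
  "base T x y \<in> base_group T \<longleftrightarrow> x \<in> carrier T \<and> y \<in> carrier T"
  "twist T x y \<notin> base_group T"
  using swap_neq_one by (auto simp: base_def twist_def base_group_def)

lemma base_group_eq: "base_group T = {base T x y | x y. x \<in> carrier T \<and> y \<in> carrier T}"
  by (auto simp: base_def base_group_def)

text \<open>Moving the swap of the left factor past the right factor exchanges the coordinates of
  the latter.\<close>

lemma mult_simps [simp]:
  assumes "x \<in> carrier T" "y \<in> carrier T" "u \<in> carrier T" "v \<in> carrier T"
  shows "base T x y \<otimes>\<^bsub>G\<^esub> base T u v = base T (x \<otimes> u) (y \<otimes> v)"
    and "base T x y \<otimes>\<^bsub>G\<^esub> twist T u v = twist T (x \<otimes> u) (y \<otimes> v)"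
    and "twist T x y \<otimes>\<^bsub>G\<^esub> base T u v = twist T (x \<otimes> v) (y \<otimes> u)"
    and "twist T x y \<otimes>\<^bsub>G\<^esub> twist T u v = base T (x \<otimes> v) (y \<otimes> u)"
proof -
  interpret Aut: group "AutoGroup (T \<times>\<times> T)" by (rule T.group_AutoGroup_DirProd)
  have "swap T \<in> carrier (AutoGroup (T \<times>\<times> T))"
    by (simp add: carrier_AutoGroup T.swap_in_auto)
  moreover have "swap T (u, v) = (v, u)" "\<one>\<^bsub>AutoGroup (T \<times>\<times> T)\<^esub> (u, v) = (u, v)"
    using assms by (simp_all add: swap_def one_AutoGroup)
  ultimately show "base T x y \<otimes>\<^bsub>G\<^esub> base T u v = base T (x \<otimes> u) (y \<otimes> v)"
    "base T x y \<otimes>\<^bsub>G\<^esub> twist T u v = twist T (x \<otimes> u) (y \<otimes> v)"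
    "twist T x y \<otimes>\<^bsub>G\<^esub> base T u v = twist T (x \<otimes> v) (y \<otimes> u)"
    "twist T x y \<otimes>\<^bsub>G\<^esub> twist T u v = base T (x \<otimes> v) (y \<otimes> u)"
    by (simp_all add: swap_extension_def semidirect_def base_def twist_def T.swap_mult_swap)
qed

lemma one_eq: "\<one>\<^bsub>G\<^esub> = base T \<one> \<one>"
  by (simp add: swap_extension_def semidirect_def base_def)

lemma inv_simps [simp]:
  assumes "x \<in> carrier T" "y \<in> carrier T"
  shows "inv\<^bsub>G\<^esub> (base T x y) = base T (inv x) (inv y)"
    and "inv\<^bsub>G\<^esub> (twist T x y) = twist T (inv y) (inv x)"
  using assms by (auto intro!: G.inv_equality simp: one_eq)

lemma base_group_normal: "base_group T \<lhd> G"
proof (rule G.normal_invI)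
  show "subgroup (base_group T) G"
  proof (rule G.subgroupI)
    show "base_group T \<noteq> {}" using base_mem_base_group(1)[of \<one> \<one>] by blast
  qed (auto simp: base_group_eq)
  fix p q assume "p \<in> carrier G" "q \<in> base_group T"
  then show "p \<otimes>\<^bsub>G\<^esub> q \<otimes>\<^bsub>G\<^esub> inv\<^bsub>G\<^esub> p \<in> base_group T"
    by (auto simp: base_group_eq elim!: carrier_cases)
qed

end

section \<open>Normal subgroups of the extension\<close>

locale nonabelian_simple_group = simple_group T for T (structure) +
  assumes nonabelian: "\<not> comm_group T"
begin

text \<open>The centre is normal, so by simplicity it is trivial or everything, and the latter would
  make \<open>T\<close> abelian.\<close>

lemma center_trivial:
  assumes "z \<in> carrier T" and "\<And>t. t \<in> carrier T \<Longrightarrow> z \<otimes> t = t \<otimes> z"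
  shows "z = \<one>"
proof -
  let ?Z = "{z \<in> carrier T. \<forall>t\<in>carrier T. z \<otimes> t = t \<otimes> z}"
  have "?Z \<lhd> T"
  proof (rule normal_invI)
    show "subgroup ?Z T"
    proof (rule subgroupI)
      show "?Z \<noteq> {}" by (auto intro!: exI[of _ \<one>])
      fix x assume x: "x \<in> ?Z"
      then have xT: "x \<in> carrier T" by simp
      have "inv x \<otimes> t = t \<otimes> inv x" if t: "t \<in> carrier T" for t
      proof -
        have "inv x \<otimes> t = inv x \<otimes> (t \<otimes> x) \<otimes> inv x" using x t by (simp add: m_assoc)
        also have "t \<otimes> x = x \<otimes> t" using x t by simp
        also have "inv x \<otimes> (x \<otimes> t) = t"
          using xT t by (simp add: m_assoc[symmetric])
        finally show ?thesis .
      qed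
      then show "inv x \<in> ?Z" using x by simp
      fix y assume y: "y \<in> ?Z"
      then have yT: "y \<in> carrier T" by simp
      have "x \<otimes> y \<otimes> t = t \<otimes> (x \<otimes> y)" if t: "t \<in> carrier T" for t
      proof -
        have xt: "x \<otimes> t = t \<otimes> x" and yt: "y \<otimes> t = t \<otimes> y" using x y t by auto
        have "x \<otimes> y \<otimes> t = x \<otimes> (y \<otimes> t)" using xT yT t by (rule m_assoc)
        also have "\<dots> = x \<otimes> t \<otimes> y" unfolding yt using xT yT t by (simp add: m_assoc)
        also have "\<dots> = t \<otimes> (x \<otimes> y)" unfolding xt using xT yT t by (simp add: m_assoc)
        finally show ?thesis .
      qed
      then show "x \<otimes> y \<in> ?Z" using xT yT by (intro CollectI conjI ballI m_closed)
    qed auto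
    fix g h assume g: "g \<in> carrier T" and h: "h \<in> ?Z"
    have gh: "h \<in> carrier T" "g \<otimes> h = h \<otimes> g"
      using h bspec[OF conjunct2[OF CollectD[OF h]] g] by simp_all
    have "g \<otimes> h \<otimes> inv g = h" unfolding gh(2) using g gh(1) by (simp add: m_assoc)
    then show "g \<otimes> h \<otimes> inv g \<in> ?Z" by (rule ssubst) (rule h)
  qed
  then consider "?Z = carrier T" | "?Z = {\<one>}" using no_real_normal_subgroup by blast
  then show ?thesis
  proof cases
    case 1
    have "comm_group T"
    proof (rule group_comm_groupI)
      fix x y assume "x \<in> carrier T" "y \<in> carrier T"
      then have "x \<in> ?Z" unfolding 1 by simp
      then show "x \<otimes> y = y \<otimes> x" using \<open>y \<in> carrier T\<close> by blast
    qed
    then show ?thesis using nonabelian by simp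
  qed (use assms in blast)
qed

end

sublocale nonabelian_simple_group \<subseteq> nontrivial_group
  by unfold_locales (rule simple_not_triv)

context nonabelian_simple_group
begin

text \<open>The elements \<open>u\<close> with \<open>(u, 1)\<close> in \<open>M\<close> form a
  nontrivial normal subgroup of \<open>T\<close>, hence all of \<open>T\<close>. Conjugation by the
  swap then yields the second factor.\<close>

lemma base_group_subset_normal_of_base:
  assumes M: "M \<lhd> G" and x: "x \<in> carrier T" "x \<noteq> \<one>" "base T x \<one> \<in> M"
  shows "base_group T \<subseteq> M"
proof -
  interpret M: normal M G by fact
  let ?L = "{x \<in> carrier T. base T x \<one> \<in> M}"
  have "?L \<lhd> T"
  proof (rule normal_invI)
    show "subgroup ?L T"
    proof (rule subgroupI)
      show "?L \<noteq> {}" using x by blast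
      show "inv u \<in> ?L" if "u \<in> ?L" for u
        using that M.m_inv_closed[of "base T u \<one>"] by simp
      show "u \<otimes> v \<in> ?L" if "u \<in> ?L" "v \<in> ?L" for u v
        using that M.m_closed[of "base T u \<one>" "base T v \<one>"] by simp
    qed auto
    show "g \<otimes> h \<otimes> inv g \<in> ?L" if "g \<in> carrier T" "h \<in> ?L" for g h
      using that M.inv_op_closed2[of "base T g \<one>" "base T h \<one>"] by simp
  qed
  then have "?L = carrier T" using no_real_normal_subgroup x by blast
  then have base1: "base T u \<one> \<in> M" if "u \<in> carrier T" for u using that by blast
  have "base T u v \<in> M" if uv: "u \<in> carrier T" "v \<in> carrier T" for u v
  proof -
    have "base T \<one> v \<in> M"
      using uv base1 M.inv_op_closed2[of "twist T \<one> \<one>" "base T v \<one>"] by simp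
    then show ?thesis using uv base1[of u] M.m_closed[of "base T u \<one>" "base T \<one> v"] by simp
  qed
  then show ?thesis by (auto simp: base_group_eq)
qed

text \<open>Any nontrivial element of \<open>M\<close> is reduced to some \<open>(u, 1)\<close> with
  \<open>u\<close> nontrivial, by commutators with elements \<open>(t, 1)\<close> and conjugation by
  the swap.\<close>

lemma base_group_subset_normal:
  assumes M: "M \<lhd> G" and "M \<noteq> {\<one>\<^bsub>G\<^esub>}"
  shows "base_group T \<subseteq> M"
proof -
  interpret M: normal M G by fact
  have commutator: "m \<otimes>\<^bsub>G\<^esub> (g \<otimes>\<^bsub>G\<^esub> inv\<^bsub>G\<^esub> m \<otimes>\<^bsub>G\<^esub> inv\<^bsub>G\<^esub> g) \<in> M" if "m \<in> M" "g \<in> carrier G" for m g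
    using that M.inv_op_closed2 by simp
  have left: ?thesis if m: "base T x y \<in> M" "x \<noteq> \<one>" for x y
  proof -
    have xy: "x \<in> carrier T" "y \<in> carrier T" using m M.mem_carrier by fastforce+
    \<comment> \<open>The commutator with \<open>(t, 1)\<close> is trivial in the second coordinate
      and, for this \<open>t\<close>, nontrivial in the first.\<close>
    then obtain t where t: "t \<in> carrier T" "x \<otimes> t \<noteq> t \<otimes> x" using center_trivial m by metis
    have "base T (x \<otimes> (t \<otimes> inv x \<otimes> inv t)) \<one> \<in> M"
      using commutator[of "base T x y" "base T t \<one>"] m xy t by simp
    moreover have "x \<otimes> (t \<otimes> inv x \<otimes> inv t) \<noteq> \<one>"
    proof
      assume "x \<otimes> (t \<otimes> inv x \<otimes> inv t) = \<one>"
      then have "x \<otimes> t \<otimes> inv (t \<otimes> x) = \<one>" using xy t by (simp add: inv_mult_group m_assoc)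
      then have "x \<otimes> t = t \<otimes> x" using xy t by (metis inv_inv inv_equality inv_closed m_closed)
      then show False using t by simp
    qed
    ultimately show ?thesis
      using base_group_subset_normal_of_base[OF M, of "x \<otimes> (t \<otimes> inv x \<otimes> inv t)"] xy t by simp
  qed
  have in_base: ?thesis if m: "base T x y \<in> M" "base T x y \<noteq> \<one>\<^bsub>G\<^esub>" for x y
  proof (cases "x = \<one>")
    case True
    have xy: "x \<in> carrier T" "y \<in> carrier T" using m M.mem_carrier by fastforce+
    \<comment> \<open>With \<open>x\<close> trivial, \<open>y\<close> is not; the swap brings it
      into first position.\<close>
    then have "base T y x \<in> M" using m M.inv_op_closed2[of "twist T \<one> \<one>" "base T x y"] by simp
    then show ?thesis using m True by (intro left[of y x]) (auto simp: one_eq)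
  qed (use m left in simp)
  obtain p where p: "p \<in> M" "p \<noteq> \<one>\<^bsub>G\<^esub>" using assms M.one_closed by blast
  from p M.mem_carrier have "p \<in> carrier G" by blast
  then show ?thesis
  proof (cases p rule: carrier_cases)
    case (base x y)
    then show ?thesis using p in_base by simp
  next
    case (twist x y)
    obtain t where t: "t \<in> carrier T" "t \<noteq> \<one>" using nontrivial by blast
    \<comment> \<open>The commutator of \<open>(x, y) \<iota>\<close> and \<open>(t, 1)\<close> is \<open>(t\<inverse>, y t y\<inverse>)\<close>.\<close>
    have "x \<otimes> (inv x \<otimes> inv t) = inv t"
      using twist t by (simp add: m_assoc[symmetric])
    then have "base T (inv t) (y \<otimes> (t \<otimes> inv y)) \<in> M"
      using commutator[of p "base T t \<one>"] p twist t by simp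
    then show ?thesis using in_base[of "inv t" "y \<otimes> (t \<otimes> inv y)"] t by (simp add: one_eq)
  qed
qed

lemma base_group_minimal_normal: "minimal_normal (base_group T) G"
  unfolding minimal_normal_def
proof (intro conjI allI impI base_group_normal)
  obtain t where "t \<in> carrier T" "t \<noteq> \<one>" using nontrivial by blast
  then have "base T t t \<in> base_group T" "base T t t \<noteq> \<one>\<^bsub>G\<^esub>" by (simp_all add: one_eq)
  then show "base_group T \<noteq> {\<one>\<^bsub>G\<^esub>}" by blast
  show "L = base_group T" if "L \<lhd> G \<and> L \<subseteq> base_group T \<and> L \<noteq> {\<one>\<^bsub>G\<^esub>}" for L
    using that base_group_subset_normal by blast
qed

text \<open>A minimal normal \<open>M\<close> contains the normal subgroup
  \<open>base_group T\<close>, and minimality turns inclusion into equality.\<close>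

lemma minimal_normal_unique: "minimal_normal M G \<Longrightarrow> M = base_group T"
  using base_group_minimal_normal base_group_subset_normal unfolding minimal_normal_def by metis

end

section \<open>Subdirect subgroups of \<open>T \<times> T\<close> and generation\<close>

text \<open>Goursat's lemma for a simple group. Surjectivity of the projections makes
  \<open>?K1\<close> and \<open>?K2\<close> normal. If either is everything, so is \<open>L\<close>;
  if both are trivial, \<open>L\<close> is the graph of an automorphism.\<close>

lemma (in simple_group) subdirect_square_cases:
  assumes L: "subgroup L (G \<times>\<times> G)"
    and fst: "fst ` L = carrier G" and snd: "snd ` L = carrier G"
  shows "L = carrier G \<times> carrier G \<or>
    (\<exists>c\<in>auto G. \<forall>x\<in>carrier G. \<forall>y\<in>carrier G. (x, y) \<in> L \<longleftrightarrow> y = c x)"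
proof -
  interpret L: subgroup L "G \<times>\<times> G" by fact
  have mem: "x \<in> carrier G \<and> y \<in> carrier G" if "(x, y) \<in> L" for x y
    using L.mem_carrier[OF that] by simp
  have mult: "(x \<otimes> u, y \<otimes> v) \<in> L" if "(x, y) \<in> L" "(u, v) \<in> L" for x y u v
    using L.m_closed[OF that] by simp
  have inv: "(inv x, inv y) \<in> L" if "(x, y) \<in> L" for x y
    using L.m_inv_closed[OF that] mem[OF that] by simp
  have one: "(\<one>, \<one>) \<in> L" using L.one_closed by simp
  have left: "\<exists>y. (x, y) \<in> L" if "x \<in> carrier G" for x using that fst by force
  have right: "\<exists>x. (x, y) \<in> L" if "y \<in> carrier G" for y using that snd by force
  let ?K1 = "{x \<in> carrier G. (x, \<one>) \<in> L}" and ?K2 = "{y \<in> carrier G. (\<one>, y) \<in> L}"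
  have "?K1 \<lhd> G"
  proof (rule normal_invI)
    show "subgroup ?K1 G"
    proof (rule subgroupI)
      show "?K1 \<noteq> {}" using one by blast
      show "inv x \<in> ?K1" if "x \<in> ?K1" for x using that inv[of x \<one>] by simp
      show "x \<otimes> y \<in> ?K1" if "x \<in> ?K1" "y \<in> ?K1" for x y
        using that mult[of x \<one> y \<one>] by simp
    qed simp
    fix g h assume g: "g \<in> carrier G" and h: "h \<in> ?K1"
    \<comment> \<open>Conjugation by \<open>(g, k)\<close> inside \<open>L\<close> acts as
      \<open>g\<close> on the first coordinate and fixes the trivial second one.\<close>
    obtain k where k: "(g, k) \<in> L" using left g by blast
    have "(g \<otimes> h \<otimes> inv g, k \<otimes> \<one> \<otimes> inv k) \<in> L"
      using h by (intro mult inv k) simp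
    then show "g \<otimes> h \<otimes> inv g \<in> ?K1" using g h mem[OF k] by simp
  qed
  then consider "?K1 = carrier G" | "?K1 = {\<one>}" using no_real_normal_subgroup by metis
  then show ?thesis
  proof cases
    case 1
    have "(x, y) \<in> L" if xy: "x \<in> carrier G" "y \<in> carrier G" for x y
    proof -
      \<comment> \<open>A partner \<open>u\<close> of \<open>y\<close> is corrected to
        \<open>x\<close> by the factor \<open>(x \<otimes> inv u, \<one>)\<close>.\<close>
      obtain u where u: "(u, y) \<in> L" using right xy by blast
      then have "x \<otimes> inv u \<in> ?K1" unfolding 1 using xy mem by blast
      then show ?thesis using mult[OF _ u, of "x \<otimes> inv u" \<one>] mem[OF u] xy by (simp add: m_assoc)
    qed
    then have "L = carrier G \<times> carrier G" by (intro equalityI subrelI) (auto dest: mem)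
    then show ?thesis ..
  next
    case K1: 2
    have "?K2 \<lhd> G"
    proof (rule normal_invI)
      show "subgroup ?K2 G"
      proof (rule subgroupI)
        show "?K2 \<noteq> {}" using one by blast
        show "inv x \<in> ?K2" if "x \<in> ?K2" for x using that inv[of \<one> x] by simp
        show "x \<otimes> y \<in> ?K2" if "x \<in> ?K2" "y \<in> ?K2" for x y
          using that mult[of \<one> x \<one> y] by simp
      qed simp
      fix g h assume g: "g \<in> carrier G" and h: "h \<in> ?K2"
      obtain k where k: "(k, g) \<in> L" using right g by blast
      have "(k \<otimes> \<one> \<otimes> inv k, g \<otimes> h \<otimes> inv g) \<in> L"
        using h by (intro mult inv k) simp
      then show "g \<otimes> h \<otimes> inv g \<in> ?K2" using g h mem[OF k] by simp
    qed
    then consider "?K2 = carrier G" | "?K2 = {\<one>}" using no_real_normal_subgroup by metis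
    then show ?thesis
    proof cases
      case 1
      have "(x, y) \<in> L" if xy: "x \<in> carrier G" "y \<in> carrier G" for x y
      proof -
        obtain v where v: "(x, v) \<in> L" using left xy by blast
        then have "y \<otimes> inv v \<in> ?K2" unfolding 1 using xy mem by blast
        then show ?thesis using mult[OF _ v, of \<one> "y \<otimes> inv v"] mem[OF v] xy by (simp add: m_assoc)
      qed
      then have "L = carrier G \<times> carrier G" by (intro equalityI subrelI) (auto dest: mem)
    then show ?thesis ..
    next
      case K2: 2
      have unique_right: "y = v" if "(x, y) \<in> L" "(x, v) \<in> L" for x y v
      proof -
        have "y \<otimes> inv v \<in> ?K2"
          using mult[OF that(1) inv[OF that(2)]] mem[OF that(1)] mem[OF that(2)] by simp
        then have "y \<otimes> inv v = \<one>" unfolding K2 by simp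
        then show ?thesis using mem[OF that(1)] mem[OF that(2)] by (simp add: inv_solve_right')
      qed
      have unique_left: "x = u" if "(x, y) \<in> L" "(u, y) \<in> L" for x y u
      proof -
        have "x \<otimes> inv u \<in> ?K1"
          using mult[OF that(1) inv[OF that(2)]] mem[OF that(1)] mem[OF that(2)] by simp
        then have "x \<otimes> inv u = \<one>" unfolding K1 by simp
        then show ?thesis using mem[OF that(1)] mem[OF that(2)] by (simp add: inv_solve_right')
      qed
      \<comment> \<open>By \<open>unique_right\<close> the choice has only one candidate; the
        restriction provides extensionality for \<open>auto\<close>.\<close>
      define c where "c = (\<lambda>x\<in>carrier G. SOME y. (x, y) \<in> L)"
      have c: "(x, c x) \<in> L" if "x \<in> carrier G" for x
        using someI_ex[OF left[OF that]] that by (simp add: c_def)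
      have "bij_betw c (carrier G) (carrier G)"
        unfolding bij_betw_def
      proof (intro conjI inj_onI equalityI subsetI)
        show "x = y" if "x \<in> carrier G" "y \<in> carrier G" "c x = c y" for x y
          using c[OF that(1)] c[OF that(2)] that(3) by (intro unique_left[of x "c x" y]) simp_all
        show "y \<in> carrier G" if "y \<in> c ` carrier G" for y
          using that c mem by blast
        fix y assume "y \<in> carrier G"
        then obtain x where x: "(x, y) \<in> L" using right by blast
        moreover have "x \<in> carrier G" using mem[OF x] by simp
        ultimately have "y = c x" using unique_right c by blast
        then show "y \<in> c ` carrier G" using \<open>x \<in> carrier G\<close> by blast
      qed
      moreover have "c \<in> hom G G"
      proof (rule homI)
        show "c x \<in> carrier G" if "x \<in> carrier G" for x using mem[OF c[OF that]] by simp
        show "c (x \<otimes> y) = c x \<otimes> c y" if "x \<in> carrier G" "y \<in> carrier G" for x y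
          using unique_right[OF c[OF m_closed[OF that]] mult[OF c[OF that(1)] c[OF that(2)]]] .
      qed
      moreover have "c \<in> extensional (carrier G)" by (simp add: c_def)
      ultimately have "c \<in> auto G" by (simp add: auto_def Bij_def)
      moreover have "(x, y) \<in> L \<longleftrightarrow> y = c x" if "x \<in> carrier G" for x y
        using unique_right c[OF that] by blast
      ultimately show ?thesis by blast
    qed
  qed
qed

section \<open>The generating pair\<close>

locale involution_generated = nonabelian_simple_group +
  fixes a b
  assumes finite_T: "finite (carrier T)"
    and a [simp]: "a \<in> carrier T" and b [simp]: "b \<in> carrier T"
    and a_neq_one: "a \<noteq> \<one>" and a_square [simp]: "a \<otimes> a = \<one>"
    and generate_ab: "generate T {a, b} = carrier T"
    and no_auto: "\<And>c. c \<in> aut_centralizer T a \<Longrightarrow> c b \<noteq> b \<otimes> a"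
begin

lemma inv_a [simp]: "inv a = a"
  by (rule inv_equality) auto

lemma cancel [simp]:
  "x \<in> carrier T \<Longrightarrow> a \<otimes> (a \<otimes> x) = x"
  "x \<in> carrier T \<Longrightarrow> b \<otimes> (inv b \<otimes> x) = x"
  "x \<in> carrier T \<Longrightarrow> inv b \<otimes> (b \<otimes> x) = x"
  by (simp_all add: m_assoc[symmetric])

lemma subset_generate_ab:
  assumes "subgroup K T" "a \<in> K" "b \<in> K"
  shows "K = carrier T"
  using generate_subgroup_incl[of "{a, b}" K] assms generate_ab subgroup.subset[OF assms(1)] by auto

text \<open>Otherwise the centralizer of \<open>a\<close> contains both generators, so
  \<open>a\<close> is central and hence trivial.\<close>

lemma a_b_not_commute: "a \<otimes> b \<noteq> b \<otimes> a"
proof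
  assume ab: "a \<otimes> b = b \<otimes> a"
  let ?C = "{x \<in> carrier T. a \<otimes> x = x \<otimes> a}"
  have "subgroup ?C T"
  proof (rule subgroupI)
    show "?C \<noteq> {}" using a by blast
    fix x assume x: "x \<in> ?C"
    then have xT: "x \<in> carrier T" and ax: "a \<otimes> x = x \<otimes> a" by auto
    have "a \<otimes> inv x = inv (x \<otimes> a)" using xT by (simp add: inv_mult_group)
    also have "\<dots> = inv x \<otimes> a" unfolding ax[symmetric] using xT by (simp add: inv_mult_group)
    finally show "inv x \<in> ?C" using xT by simp
    fix y assume y: "y \<in> ?C"
    then have yT: "y \<in> carrier T" and ay: "a \<otimes> y = y \<otimes> a" by auto
    have "a \<otimes> (x \<otimes> y) = x \<otimes> (a \<otimes> y)" using xT yT ax by (simp add: m_assoc[symmetric])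
    also have "\<dots> = x \<otimes> y \<otimes> a" unfolding ay using xT yT by (simp add: m_assoc)
    finally show "x \<otimes> y \<in> ?C" using xT yT by simp
  qed auto
  then have "?C = carrier T" by (rule subset_generate_ab) (use ab in simp_all)
  then have "a = \<one>" by (intro center_trivial) auto
  then show False using a_neq_one by simp
qed

text \<open>Elements of \<open>H\<close> have coordinates \<open>\<one>\<close> or \<open>a\<close>
  only. Keeping these conjugates of \<open>a\<close> outside that set is what separates the cosets
  in \<open>card_out\<close> and \<open>card_in\<close>.\<close>

lemma not_conj_a:
  "b \<otimes> (a \<otimes> inv b) \<noteq> \<one>" "b \<otimes> (a \<otimes> inv b) \<noteq> a"
  "inv b \<otimes> (a \<otimes> b) \<noteq> \<one>" "inv b \<otimes> (a \<otimes> b) \<noteq> a"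
proof -
  have 1: "b \<otimes> a = x \<otimes> b" if "b \<otimes> (a \<otimes> inv b) = x" "x \<in> carrier T" for x
    using that by (auto simp: m_assoc)
  have 2: "a \<otimes> b = b \<otimes> x" if "inv b \<otimes> (a \<otimes> b) = x" "x \<in> carrier T" for x
    using that by (auto simp: m_assoc)
  show "b \<otimes> (a \<otimes> inv b) \<noteq> \<one>" "b \<otimes> (a \<otimes> inv b) \<noteq> a"
    using 1[of \<one>] 1[of a] a_b_not_commute a_neq_one by auto
  show "inv b \<otimes> (a \<otimes> b) \<noteq> \<one>" "inv b \<otimes> (a \<otimes> b) \<noteq> a"
    using 2[of \<one>] 2[of a] a_b_not_commute a_neq_one by auto
qed

section \<open>The subgroup H and the element g\<close>

definition H where "H = {base T \<one> \<one>, base T a a, twist T \<one> \<one>, twist T a a}"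

definition g where "g = base T b (b \<otimes> a)"

lemma g_closed [simp]: "g \<in> carrier G"
  by (simp add: g_def)

lemma subgroup_H: "subgroup H G"
  by (rule G.subgroupI) (auto simp: H_def)

lemma generate_H: "generate G {base T a a, twist T \<one> \<one>} = H"
proof (rule G.generateI[symmetric, OF subgroup_H])
  show "{base T a a, twist T \<one> \<one>} \<subseteq> H" by (auto simp: H_def)
  fix K assume K: "subgroup K G" and "{base T a a, twist T \<one> \<one>} \<subseteq> K"
  then have in_K: "base T a a \<in> K" "twist T \<one> \<one> \<in> K" by auto
  with subgroup.m_closed[OF K in_K(1) in_K(1)] subgroup.m_closed[OF K in_K] show "H \<subseteq> K"
    by (simp add: H_def)
qed

lemma H_iso: "G\<lparr>carrier := H\<rparr> \<cong> integer_mod_group 2 \<times>\<times> integer_mod_group 2"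
proof -
  let ?Z = "integer_mod_group 2 \<times>\<times> integer_mod_group 2"
  \<comment> \<open>Here \<open>i\<close> selects the diagonal entry \<open>\<one>\<close> or
    \<open>a\<close>, and \<open>j\<close> records whether the swap occurs.\<close>
  let ?f = "\<lambda>(i :: int, j :: int). (if j = 0 then base T else twist T)
    (if i = 0 then \<one> else a) (if i = 0 then \<one> else a)"
  have Z: "carrier ?Z = {0, 1} \<times> {0, 1}"
    by (auto simp: carrier_integer_mod_group)
  interpret Z: group ?Z by (intro DirProd_group) simp_all
  have "?f \<in> iso ?Z (G\<lparr>carrier := H\<rparr>)"
    unfolding iso_def bij_betw_def hom_def Z using a_neq_one
    by (auto simp: H_def inj_on_def)
  then show ?thesis
    by (intro Z.iso_sym) (auto simp: is_iso_def)
qed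

section \<open>Generation, double cosets and quasiprimitivity\<close>

sublocale H: group_with_subgroup G H
  by (intro group_with_subgroup.intro G.is_group subgroup_H)

lemma generate_gH: "generate G (insert g H) = carrier G"
proof -
  have gH: "insert g H \<subseteq> carrier G" by (auto simp: H_def)
  interpret S: subgroup "generate G (insert g H)" G by (rule G.generate_is_subgroup[OF gH])
  \<comment> \<open>The part of the generated subgroup inside \<open>T \<times> T\<close>, as a set
    of pairs, to which the Goursat dichotomy applies.\<close>
  let ?L = "{(x, y). x \<in> carrier T \<and> y \<in> carrier T \<and> base T x y \<in> generate G (insert g H)}"
  interpret TT: group "T \<times>\<times> T" by (intro DirProd_group group_axioms)
  have inv: "base T (inv x) (inv y) \<in> generate G (insert g H)"
    if "x \<in> carrier T" "y \<in> carrier T" "base T x y \<in> generate G (insert g H)" for x y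
    using S.m_inv_closed[OF that(3)] that by simp
  have mult: "base T (x \<otimes> u) (y \<otimes> v) \<in> generate G (insert g H)"
    if "x \<in> carrier T" "y \<in> carrier T" "base T x y \<in> generate G (insert g H)"
      "u \<in> carrier T" "v \<in> carrier T" "base T u v \<in> generate G (insert g H)" for x y u v
    using S.m_closed[OF that(3,6)] that by simp
  have L: "subgroup ?L (T \<times>\<times> T)"
  proof (rule TT.subgroupI)
    have "(\<one>, \<one>) \<in> ?L" using S.one_closed by (simp add: one_eq)
    then show "?L \<noteq> {}" by blast
    show "inv\<^bsub>T \<times>\<times> T\<^esub> p \<in> ?L" if "p \<in> ?L" for p
      using that inv by auto
    show "p \<otimes>\<^bsub>T \<times>\<times> T\<^esub> q \<in> ?L" if "p \<in> ?L" "q \<in> ?L" for p q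
      using that mult by auto
  qed auto
  have aa: "(a, a) \<in> ?L" and bba: "(b, b \<otimes> a) \<in> ?L"
    by (auto simp: H_def g_def intro: generate.incl)
  have fst: "group_hom (T \<times>\<times> T) T fst" and snd: "group_hom (T \<times>\<times> T) T snd"
    by (auto simp: group_hom_def group_hom_axioms_def hom_def TT.is_group mult_DirProd')
  have "fst ` ?L = carrier T"
  proof (rule subset_generate_ab)
    show "subgroup (fst ` ?L) T" by (rule group_hom.subgroup_img_is_subgroup[OF fst L])
    show "a \<in> fst ` ?L" by (rule image_eqI[OF _ aa]) simp
    show "b \<in> fst ` ?L" by (rule image_eqI[OF _ bba]) simp
  qed
  moreover have "snd ` ?L = carrier T"
  proof (rule subset_generate_ab)
    show S: "subgroup (snd ` ?L) T" by (rule group_hom.subgroup_img_is_subgroup[OF snd L])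
    show aL: "a \<in> snd ` ?L" by (rule image_eqI[OF _ aa]) simp
    have "b \<otimes> a \<in> snd ` ?L" by (rule image_eqI[OF _ bba]) simp
    then have "b \<otimes> a \<otimes> a \<in> snd ` ?L" using aL by (rule subgroup.m_closed[OF S])
    then show "b \<in> snd ` ?L" by (simp add: m_assoc)
  qed
  ultimately have cases: "?L = carrier T \<times> carrier T \<or>
    (\<exists>c\<in>auto T. \<forall>x\<in>carrier T. \<forall>y\<in>carrier T. (x, y) \<in> ?L \<longleftrightarrow> y = c x)"
    by (rule subdirect_square_cases[OF L])
  \<comment> \<open>The pairs \<open>(a, a)\<close> and \<open>(b, b \<otimes> a)\<close> would lie
    on the graph of \<open>c\<close>, which \<open>no_auto\<close> forbids.\<close>
  have "False" if "c \<in> auto T" "\<forall>x\<in>carrier T. \<forall>y\<in>carrier T. (x, y) \<in> ?L \<longleftrightarrow> y = c x" for c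
  proof -
    have "a = c a" "b \<otimes> a = c b"
      using that(2)[rule_format, of a a] that(2)[rule_format, of b "b \<otimes> a"] aa bba by simp_all
    then have "c \<in> aut_centralizer T a" "c b = b \<otimes> a"
      using that(1) by (simp_all add: aut_centralizer_def)
    then show False using no_auto by blast
  qed
  with cases have L_eq: "?L = carrier T \<times> carrier T" by blast
  have base: "base T x y \<in> generate G (insert g H)" if "x \<in> carrier T" "y \<in> carrier T" for x y
  proof -
    have "(x, y) \<in> ?L" unfolding L_eq using that by simp
    then show ?thesis by simp
  qed
  have "twist T x y \<in> generate G (insert g H)" if "x \<in> carrier T" "y \<in> carrier T" for x y
  proof -
    have "twist T \<one> \<one> \<in> generate G (insert g H)" by (auto simp: H_def intro: generate.incl)
    from S.m_closed[OF base[OF that] this] show ?thesis using that by simp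
  qed
  then show ?thesis using base S.subset by (auto elim!: carrier_cases)
qed

text \<open>The coordinates of \<open>h g k\<close> differ by a right factor \<open>a\<close>, since
  \<open>a\<close> commutes with the entry of \<open>k\<close>; those of \<open>inv g\<close> are
  \<open>inv b\<close> and \<open>a \<otimes> inv b\<close>. Equality would make \<open>a\<close>
  commute with \<open>inv b\<close>.\<close>

lemma inv_g_notin: "inv\<^bsub>G\<^esub> g \<notin> double_coset G H g"
proof
  assume "inv\<^bsub>G\<^esub> g \<in> double_coset G H g"
  then obtain h k where hk: "h \<in> H" "k \<in> H" "inv\<^bsub>G\<^esub> g = h \<otimes>\<^bsub>G\<^esub> g \<otimes>\<^bsub>G\<^esub> k"
    by (auto simp: mem_double_coset)
  have H_cases: "\<exists>u\<in>{\<one>, a}. h = base T u u \<or> h = twist T u u" if "h \<in> H" for h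
    using that by (auto simp: H_def)
  obtain u where u: "u \<in> {\<one>, a}" "h = base T u u \<or> h = twist T u u" using H_cases hk by meson
  obtain v where v: "v \<in> {\<one>, a}" "k = base T v v \<or> k = twist T v v" using H_cases hk by meson
  have uv: "u \<in> carrier T" "v \<in> carrier T" "v \<otimes> a = a \<otimes> v" using u v by auto
  \<comment> \<open>The order of the coordinates depends on whether both or neither of
    \<open>h\<close> and \<open>k\<close> involve the swap; a single swap gives no
    \<open>base\<close> element.\<close>
  have disj: "(p = u \<otimes> (b \<otimes> v) \<and> q = u \<otimes> (b \<otimes> (a \<otimes> v))) \<or>
    (p = u \<otimes> (b \<otimes> (a \<otimes> v)) \<and> q = u \<otimes> (b \<otimes> v))"
    if "base T p q = h \<otimes>\<^bsub>G\<^esub> g \<otimes>\<^bsub>G\<^esub> k" for p q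
    using that u(2) v(2) uv(1,2) by (elim disjE) (simp_all add: g_def m_assoc)
  have "inv\<^bsub>G\<^esub> g = base T (inv b) (a \<otimes> inv b)" by (simp add: g_def inv_mult_group)
  with disj[of "inv b" "a \<otimes> inv b"] hk(3) consider
    "inv b = u \<otimes> (b \<otimes> v)" "a \<otimes> inv b = u \<otimes> (b \<otimes> (a \<otimes> v))"
    | "inv b = u \<otimes> (b \<otimes> (a \<otimes> v))" "a \<otimes> inv b = u \<otimes> (b \<otimes> v)"
    by metis
  then have "inv b \<otimes> a = a \<otimes> inv b"
  proof cases
    case 1
    from arg_cong[OF 1(1), of "\<lambda>x. x \<otimes> a"] show ?thesis
      unfolding 1(2) using uv by (simp add: m_assoc)
  next
    case 2
    from arg_cong[OF 2(1), of "\<lambda>x. x \<otimes> a"] show ?thesis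
      unfolding 2(2) using uv by (simp add: m_assoc)
  qed
  then have "b \<otimes> (inv b \<otimes> a) \<otimes> b = b \<otimes> (a \<otimes> inv b) \<otimes> b" by simp
  then show False using a_b_not_commute by (simp add: m_assoc)
qed

text \<open>Expands \<open>H\<close> as the index set of an image while leaving the \<open>H\<close>
  of the cosets folded.\<close>

lemma H_image: "f ` H = {f (base T \<one> \<one>), f (base T a a), f (twist T \<one> \<one>), f (twist T a a)}"
  by (simp add: H_def)

text \<open>Since \<open>(b, b a) \<iota> = \<iota> (b a, b)\<close> and
  \<open>(b a, b) = g (a, a)\<close>, the swap and \<open>(a, a)\<close> give the same coset. It
  differs from that of the unit, as both coordinates of the quotient are the conjugate
  \<open>b a (inv b)\<close>.\<close>

lemma card_out: "card ((\<lambda>h. H #>\<^bsub>G\<^esub> (g \<otimes>\<^bsub>G\<^esub> h)) ` H) = 2"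
proof -
  have eq: "H #>\<^bsub>G\<^esub> (g \<otimes>\<^bsub>G\<^esub> twist T \<one> \<one>) = H #>\<^bsub>G\<^esub> (g \<otimes>\<^bsub>G\<^esub> base T a a)"
    "H #>\<^bsub>G\<^esub> (g \<otimes>\<^bsub>G\<^esub> twist T a a) = H #>\<^bsub>G\<^esub> (g \<otimes>\<^bsub>G\<^esub> base T \<one> \<one>)"
    "H #>\<^bsub>G\<^esub> (g \<otimes>\<^bsub>G\<^esub> base T a a) \<noteq> H #>\<^bsub>G\<^esub> (g \<otimes>\<^bsub>G\<^esub> base T \<one> \<one>)"
    using not_conj_a by (simp_all add: H.rcos_eq_iff g_def m_assoc inv_mult_group)
      (simp_all add: H_def)
  have "(\<lambda>h. H #>\<^bsub>G\<^esub> (g \<otimes>\<^bsub>G\<^esub> h)) ` H =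
    {H #>\<^bsub>G\<^esub> (g \<otimes>\<^bsub>G\<^esub> base T \<one> \<one>), H #>\<^bsub>G\<^esub> (g \<otimes>\<^bsub>G\<^esub> base T a a)}"
    unfolding H_image eq by auto
  then show ?thesis using eq(3) by simp
qed

text \<open>Here \<open>(inv g) \<iota> = \<iota> (a, a) (inv g)\<close>, so the swap fixes the
  coset of \<open>inv g\<close>; the four elements of \<open>H\<close> pair up differently than in
  \<open>card_out\<close>.\<close>

lemma card_in: "card ((\<lambda>h. H #>\<^bsub>G\<^esub> (inv\<^bsub>G\<^esub> g \<otimes>\<^bsub>G\<^esub> h)) ` H) = 2"
proof -
  have eq: "H #>\<^bsub>G\<^esub> (inv\<^bsub>G\<^esub> g \<otimes>\<^bsub>G\<^esub> twist T \<one> \<one>) = H #>\<^bsub>G\<^esub> (inv\<^bsub>G\<^esub> g \<otimes>\<^bsub>G\<^esub> base T \<one> \<one>)"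
    "H #>\<^bsub>G\<^esub> (inv\<^bsub>G\<^esub> g \<otimes>\<^bsub>G\<^esub> twist T a a) = H #>\<^bsub>G\<^esub> (inv\<^bsub>G\<^esub> g \<otimes>\<^bsub>G\<^esub> base T a a)"
    "H #>\<^bsub>G\<^esub> (inv\<^bsub>G\<^esub> g \<otimes>\<^bsub>G\<^esub> base T a a) \<noteq> H #>\<^bsub>G\<^esub> (inv\<^bsub>G\<^esub> g \<otimes>\<^bsub>G\<^esub> base T \<one> \<one>)"
    using not_conj_a by (simp_all add: H.rcos_eq_iff g_def m_assoc inv_mult_group)
      (simp_all add: H_def)
  have "(\<lambda>h. H #>\<^bsub>G\<^esub> (inv\<^bsub>G\<^esub> g \<otimes>\<^bsub>G\<^esub> h)) ` H =
    {H #>\<^bsub>G\<^esub> (inv\<^bsub>G\<^esub> g \<otimes>\<^bsub>G\<^esub> base T \<one> \<one>), H #>\<^bsub>G\<^esub> (inv\<^bsub>G\<^esub> g \<otimes>\<^bsub>G\<^esub> base T a a)}"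
    unfolding H_image eq by auto
  then show ?thesis using eq(3) by simp
qed

lemma normal_subset_H_trivial:
  assumes "M \<lhd> G" "M \<subseteq> H"
  shows "M = {\<one>\<^bsub>G\<^esub>}"
proof (rule ccontr)
  assume neq: "M \<noteq> {\<one>\<^bsub>G\<^esub>}"
  \<comment> \<open>The contradiction comes from its unequal coordinates: every element of
    \<open>H\<close> is diagonal.\<close>
  have "base T a \<one> \<in> H"
    using base_group_subset_normal[OF assms(1) neq] assms(2) base_mem_base_group(1)[of a \<one>] a one_closed
    by blast
  then show False using a_neq_one by (simp add: H_def)
qed

lemma finite_carrier_G: "finite (carrier G)"
  using finite_T by (simp add: swap_extension_def semidirect_def generate_swap)

sublocale oriented_coset_graph G H g
  by unfold_locales
    (use finite_carrier_G inv_g_notin card_out card_in generate_gH normal_subset_H_trivial in auto)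

lemma quasiprimitive: "quasiprimitive G (rcosets\<^bsub>G\<^esub> H) (coset_action G H)"
  unfolding quasiprimitive_def
proof (intro allI impI H.transitive_coset_action)
  fix M assume M: "M \<lhd> G \<and> M \<noteq> {\<one>\<^bsub>G\<^esub>}"
  then show "subgroup M G" by (simp add: normal_imp_subgroup)
  have HM: "h \<otimes>\<^bsub>G\<^esub> m \<in> H <#>\<^bsub>G\<^esub> M" if "h \<in> H" "m \<in> M" for h m
    using that by (auto simp: set_mult_def)
  show "carrier G \<subseteq> H <#>\<^bsub>G\<^esub> M"
  proof
    fix p assume "p \<in> carrier G"
    then show "p \<in> H <#>\<^bsub>G\<^esub> M"
    proof (cases p rule: carrier_cases)
      case (base x y)
      then have "base T x y \<in> M"
        using M base_group_subset_normal[of M] base_mem_base_group(1)[of x y] by blast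
      then show ?thesis using HM[of "base T \<one> \<one>" "base T x y"] base by (simp add: H_def)
    next
      case (twist x y)
      \<comment> \<open>The factorization is \<open>(x, y) \<iota> = \<iota> (y, x)\<close>.\<close>
      then have "base T y x \<in> M"
        using M base_group_subset_normal[of M] base_mem_base_group(1)[of y x] by blast
      then show ?thesis using HM[of "twist T \<one> \<one>" "base T y x"] twist by (simp add: H_def)
    qed
  qed
qed

end

theorem lemma5p6:
  fixes T :: "('a, 'm) monoid_scheme" and a b :: 'a
    and N :: "('a \<times> 'a) monoid"
    and \<iota> :: "'a \<times> 'a \<Rightarrow> 'a \<times> 'a"
    and G :: "(('a \<times> 'a) \<times> ('a \<times> 'a \<Rightarrow> 'a \<times> 'a)) monoid"
    and N' H :: "(('a \<times> 'a) \<times> ('a \<times> 'a \<Rightarrow> 'a \<times> 'a)) set"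
    and g :: "('a \<times> 'a) \<times> ('a \<times> 'a \<Rightarrow> 'a \<times> 'a)"
    and \<Gamma> :: "(('a \<times> 'a) \<times> ('a \<times> 'a \<Rightarrow> 'a \<times> 'a)) set pair_pre_digraph"
  assumes "simple_group T" and "finite (carrier T)" and "\<not> comm_group T"
    and "a \<in> carrier T" and "b \<in> carrier T"
    and "generate T {a, b} = carrier T"
    and "group.ord T a = 2"
    and "\<forall>c \<in> aut_centralizer T a. c b \<noteq> b \<otimes>\<^bsub>T\<^esub> a"
    and "N = T \<times>\<times> T"
    and "\<iota> = (\<lambda>(x, y) \<in> carrier N. (y, x))"
    and "G = semidirect N (generate (AutoGroup N) {\<iota>})"
    and "N' = carrier N \<times> {\<one>\<^bsub>AutoGroup N\<^esub>}"
    and "H = generate G {((a, a), \<one>\<^bsub>AutoGroup N\<^esub>), (\<one>\<^bsub>N\<^esub>, \<iota>)}"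
    and "g = ((b, b \<otimes>\<^bsub>T\<^esub> a), \<one>\<^bsub>AutoGroup N\<^esub>)"
    and "\<Gamma> = coset_graph G H g"
  shows "basic_quasiprimitive \<Gamma> G (coset_action G H) \<and>
    minimal_normal N' G \<and> (\<forall>M. minimal_normal M G \<longrightarrow> M = N') \<and>
    G\<lparr>carrier := H\<rparr> \<cong> integer_mod_group 2 \<times>\<times> integer_mod_group 2"
proof -
  interpret simple_group T by fact
  \<comment> \<open>Order two is split into the two equational facts used by the locale.\<close>
  have a: "a \<noteq> \<one>\<^bsub>T\<^esub>" "a \<otimes>\<^bsub>T\<^esub> a = \<one>\<^bsub>T\<^esub>"
    using assms(4,7) ord_eq_1[of a] pow_ord_eq_1[of a] by (auto simp: numeral_2_eq_2)
  interpret P: involution_generated T a b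
    by unfold_locales (use assms(2-8) a in auto)
  have \<iota>: "\<iota> = swap T" using assms(9,10) by (simp add: swap_def)
  have G: "G = swap_extension T" using assms(9,11) \<iota> by (simp add: swap_extension_def)
  have N': "N' = base_group T" using assms(9,12) by (simp add: base_group_def)
  have H: "H = P.H"
    using assms(9,13) P.generate_H G \<iota> by (simp add: base_def twist_def)
  have g: "g = P.g" using assms(9,14) by (simp add: P.g_def base_def)
  show ?thesis
    unfolding assms(15) G H g N' basic_quasiprimitive_def
    unfolding P.H.pverts_coset_graph
    by (intro conjI allI impI P.in_OG4 P.quasiprimitive P.base_group_minimal_normal
        P.minimal_normal_unique P.H_iso)
qed

end
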